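(* Let $M$ be an $n$-dimensional $C^2$-smooth manifold and $f\colon M\to\mathbb{R}$ a $C^2$-smooth function with a non-degenerate critical point $p^*$. Assume there are a chart $(U_0,\varphi_0)$ on $M$ with $p^*\in U_0$, $\varphi_0(p^* )=0$, and an $\eta>0$, such that $\widehat f=f\circ\varphi_0^{-1}$ satisfies $\|[H_{\widehat f}(x)-H_{\widehat f}(0)]x\|\le\eta\|x\|^2$ for $x\in\varphi_0(U_0)$. Let $\Sigma=\{\Sigma_p\mid p\in M\}$ be an indexed family of sets $\Sigma_p$ of pairs $(\phi_p,\psi_p)$ of maps $T_pM\to M$, and consider a path-dependent Newton iterate with respect to $\Sigma$, $$p_{k+1}=E_f^{(k,p_0,\dots,p_{k-1})}(p_k)=\psi_{(k)}\circ N_{f\circ\phi_{(k)}}(0_{p_k}),$$ where the rule for choosing the pair $(\phi_{(k)},\psi_{(k)})\in\Sigma_{p_k}$ may depend on the past iterates $p_0,\dots,p_{k-1}$ as well as on $k$ and $p_k$. If $\Sigma$ satisfies conditions E0--E2 (defined in the context) then this path-dependent Newton iterate converges locally quadratically to $p^*$.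
   Context: Notation. $\|\cdot\|$ is the Euclidean norm on $\mathbb{R}^n$; $\nabla g$, $H_g$ are the Euclidean gradient and Hessian; $\|D^2h(x)\|=\sup_{\|\eta\|=1}\|D^2h(x)\cdot(\eta,\eta)\|$. A critical point ($Df(p^* )=0$) is non-degenerate if the Hessian of $f$ there is invertible. The Newton iteration function of a real function $g$ on a finite-dimensional real vector space is $N_g(x)=x-[H_g(x)]^{-1}\nabla g(x)$; it is independent of the choice of inner product and requires only the first and second derivatives of $g$ at $x$. $0_p$ is the zero of $T_pM$. Convergence of a path-dependent iterate. Local quadratic convergence to $p^*$ means: there are a coordinate chart $\varphi$ around $p^*$, an open neighbourhood $V$ of $p^*$ in its domain and a constant $\kappa$ such that whenever $p_0\in V$, all iterates $p_k$ are well-defined and lie in $V$, $p_k\to p^*$, and $\|\varphi(p_{k+1})-\varphi(p^* )\|\le\kappa\|\varphi(p_k)-\varphi(p^* )\|^2$ for all $k$. For a $C^2$-chart $(U,\varphi)$ and $p\in U$, $A_p\colon T_pM\to\mathbb{R}^n$ is the linear isomorphism sending $\sum_j\eta^j\,\partial/\partial\varphi_j|_p$ to $(\eta^1,\dots,\eta^n)$. Conditions E0--E2. $\Sigma_p$ is non-empty for all $p\in M$ and, for every $q\in M$, there exist a $C^2$-chart $(U,\varphi)$ with $\varphi(q)=0$, a $\rho>0$ and $\alpha,\beta\in\mathbb{R}$ such that for all $p\in U$ and all $(\phi_p,\psi_p)\in\Sigma_p$: (E0) $\phi_p(0_p)=\psi_p(0_p)=p$ and $D\phi_p(0_p)=D\psi_p(0_p)=I$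 (identifying $T_{0_p}(T_pM)$ with $T_pM$); (E1) $\widehat\phi_p=\varphi\circ\phi_p\circ A_p^{-1}$ satisfies $\|D^2\widehat\phi_p(0)\|\le\alpha$ (in particular this second derivative exists); (E2) $\widehat\psi_p=\varphi\circ\psi_p\circ A_p^{-1}$ satisfies $\|\widehat\psi_p(y)-\varphi(p)-y\|\le\beta\|y\|^2$ whenever $\|y\|<\rho$ (in particular $\widehat\psi_p(y)$ is defined for such $y$). *)

theory Defs
  imports "HOL-Analysis.Analysis"
begin

definition C2_on :: "'a::real_normed_vector set \<Rightarrow> ('a \<Rightarrow> 'b::real_normed_vector) \<Rightarrow> bool" where
  "C2_on S h \<longleftrightarrow> (\<exists>(h' :: 'a \<Rightarrow> 'a \<Rightarrow>\<^sub>L 'b) (h'' :: 'a \<Rightarrow> 'a \<Rightarrow>\<^sub>L 'a \<Rightarrow>\<^sub>L 'b).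
     (\<forall>x\<in>S. (h has_derivative blinfun_apply (h' x)) (at x)) \<and>
     (\<forall>x\<in>S. (h' has_derivative blinfun_apply (h'' x)) (at x)) \<and>
     continuous_on S h'')"

definition has_second_derivative ::
    "('a::real_normed_vector \<Rightarrow> 'b::real_normed_vector) \<Rightarrow> ('a \<Rightarrow>\<^sub>L 'a \<Rightarrow>\<^sub>L 'b) \<Rightarrow> 'a \<Rightarrow> bool" where
  "has_second_derivative h B x \<longleftrightarrow> (\<exists>h' :: 'a \<Rightarrow> 'a \<Rightarrow>\<^sub>L 'b.
     (\<forall>\<^sub>F y in nhds x. (h has_derivative blinfun_apply (h' y)) (at y)) \<and>
     (h' has_derivative blinfun_apply B) (at x))"

definition second_derivative_norm ::
    "('a::real_normed_vector \<Rightarrow>\<^sub>L 'a \<Rightarrow>\<^sub>L 'b::real_normed_vector) \<Rightarrow> real" where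
  "second_derivative_norm B = (SUP \<eta>\<in>sphere 0 1. norm (blinfun_apply (blinfun_apply B \<eta>) \<eta>))"

definition gradient :: "(real^'n \<Rightarrow> real) \<Rightarrow> real^'n \<Rightarrow> real^'n" where
  "gradient g x = (THE D. GDERIV g x :> D)"

definition hessian :: "(real^'n \<Rightarrow> real) \<Rightarrow> real^'n \<Rightarrow> real^'n^'n" where
  "hessian g x = jacobian (gradient g) (at x)"

definition newton :: "(real^'n \<Rightarrow> real) \<Rightarrow> real^'n \<Rightarrow> real^'n" where
  "newton g x = x - matrix_inv (hessian g x) *v gradient g x"

definition newton_defined :: "(real^'n \<Rightarrow> real) \<Rightarrow> real^'n \<Rightarrow> bool" where
  "newton_defined g x \<longleftrightarrow> (\<exists>B. has_second_derivative g B x) \<and> invertible (hessian g x)"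

text \<open>
  A manifold is a Hausdorff, second countable type \<open>'m\<close> together with a \<open>C\<^sup>2\<close>-atlas; its dimension
  is \<open>CARD('n)\<close>. A chart is a pair \<open>(U, \<phi>)\<close>; the values of the total function \<open>\<phi>\<close> outside \<open>U\<close> are
  irrelevant.
\<close>

type_synonym ('m, 'n) chart = "'m set \<times> ('m \<Rightarrow> real^'n)"

abbreviation chart_inv :: "('m, 'n::finite) chart \<Rightarrow> real^'n \<Rightarrow> 'm" where
  "chart_inv c \<equiv> inv_into (fst c) (snd c)"

definition is_chart :: "('m::topological_space, 'n::finite) chart \<Rightarrow> bool" where
  "is_chart c \<longleftrightarrow> open (fst c) \<and> open (snd c ` fst c) \<and>
     homeomorphism (fst c) (snd c ` fst c) (snd c) (chart_inv c)"

definition transition :: "('m, 'n::finite) chart \<Rightarrow> ('m, 'n) chart \<Rightarrow> real^'n \<Rightarrow> real^'n" where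
  "transition c c' = snd c' \<circ> chart_inv c"

definition C2_compatible :: "('m, 'n::finite) chart \<Rightarrow> ('m, 'n) chart \<Rightarrow> bool" where
  "C2_compatible c c' \<longleftrightarrow>
     C2_on (snd c ` (fst c \<inter> fst c')) (transition c c') \<and>
     C2_on (snd c' ` (fst c' \<inter> fst c)) (transition c' c)"

definition C2_manifold ::
    "('m::{t2_space, second_countable_topology}, 'n::finite) chart set \<Rightarrow> bool" where
  "C2_manifold \<A> \<longleftrightarrow> (\<forall>c\<in>\<A>. is_chart c) \<and> (\<Union>c\<in>\<A>. fst c) = UNIV \<and>
     (\<forall>c\<in>\<A>. \<forall>c'\<in>\<A>. C2_compatible c c')"

definition C2_charts :: "('m::topological_space, 'n::finite) chart set \<Rightarrow> ('m, 'n) chart set" where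
  "C2_charts \<A> = {c. is_chart c \<and> (\<forall>a\<in>\<A>. C2_compatible a c)}"

definition charts_at :: "('m::topological_space, 'n::finite) chart set \<Rightarrow> 'm \<Rightarrow> ('m, 'n) chart set" where
  "charts_at \<A> p = {c \<in> C2_charts \<A>. p \<in> fst c}"

definition C2_fun :: "('m::topological_space, 'n::finite) chart set \<Rightarrow> ('m \<Rightarrow> real) \<Rightarrow> bool" where
  "C2_fun \<A> f \<longleftrightarrow> (\<forall>c \<in> C2_charts \<A>. C2_on (snd c ` fst c) (f \<circ> chart_inv c))"

definition critical_point ::
    "('m::topological_space, 'n::finite) chart set \<Rightarrow> ('m \<Rightarrow> real) \<Rightarrow> 'm \<Rightarrow> bool" where
  "critical_point \<A> f p \<longleftrightarrow>
     (\<forall>c \<in> charts_at \<A> p. ((f \<circ> chart_inv c) has_derivative (\<lambda>_. 0)) (at (snd c p)))"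

text \<open>At a critical point, invertibility of the Hessian matrix does not depend on the chart.\<close>

definition nondegenerate_critical_point ::
    "('m::topological_space, 'n::finite) chart set \<Rightarrow> ('m \<Rightarrow> real) \<Rightarrow> 'm \<Rightarrow> bool" where
  "nondegenerate_critical_point \<A> f p \<longleftrightarrow> critical_point \<A> f p \<and>
     (\<forall>c \<in> charts_at \<A> p. invertible (hessian (f \<circ> chart_inv c) (snd c p)))"

text \<open>
  A tangent vector at \<open>p\<close> assigns to every chart of the maximal atlas around \<open>p\<close> its coordinate vector
  in that chart, subject to the contravariant transformation rule. (Derivations would not do: on
  \<open>C\<^sup>2\<close>-functions they form an infinite-dimensional space.) The vector space operations are pointwise.
  A map \<open>T\<^sub>pM \<rightarrow> M\<close> is a function on the type \<open>('m, 'n) tangent\<close> of which only the restriction to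
  \<open>tangent_space \<A> p\<close> matters.
\<close>

type_synonym ('m, 'n) tangent = "('m, 'n) chart \<Rightarrow> real^'n"

definition tangent_space ::
    "('m::topological_space, 'n::finite) chart set \<Rightarrow> 'm \<Rightarrow> ('m, 'n) tangent set" where
  "tangent_space \<A> p = {v. (\<forall>c. c \<notin> charts_at \<A> p \<longrightarrow> v c = 0) \<and>
     (\<forall>c \<in> charts_at \<A> p. \<forall>c' \<in> charts_at \<A> p.
        v c' = frechet_derivative (transition c c') (at (snd c p)) (v c))}"

definition zero_tangent :: "('m, 'n::finite) tangent" where
  "zero_tangent = (\<lambda>_. 0)"

text \<open>This is the isomorphism \<open>A\<^sub>p\<close> of the chart \<open>c\<close>; \<open>tangent_vec\<close> is its inverse.\<close>

definition tangent_coord :: "('m, 'n::finite) chart \<Rightarrow> ('m, 'n) tangent \<Rightarrow> real^'n" where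
  "tangent_coord c v = v c"

definition tangent_vec ::
    "('m::topological_space, 'n::finite) chart set \<Rightarrow> ('m, 'n) chart \<Rightarrow> 'm \<Rightarrow> real^'n \<Rightarrow> ('m, 'n) tangent" where
  "tangent_vec \<A> c p = inv_into (tangent_space \<A> p) (tangent_coord c)"

definition local_rep ::
    "('m::topological_space, 'n::finite) chart set \<Rightarrow> ('m, 'n) chart \<Rightarrow> 'm \<Rightarrow>
     (('m, 'n) tangent \<Rightarrow> 'm) \<Rightarrow> real^'n \<Rightarrow> real^'n" where
  "local_rep \<A> c p \<phi> = snd c \<circ> \<phi> \<circ> tangent_vec \<A> c p"

text \<open>
  Differentiability at \<open>0\<^sub>p\<close> of a map \<open>\<phi>: T\<^sub>pM \<rightarrow> M\<close>, with differential \<open>L: T\<^sub>pM \<rightarrow> T\<^sub>q M\<close> where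
  \<open>q = \<phi> 0\<^sub>p\<close> and the tangent space of \<open>T\<^sub>pM\<close> at \<open>0\<^sub>p\<close> is identified with \<open>T\<^sub>pM\<close>.
\<close>

definition has_differential_at_zero ::
    "('m::topological_space, 'n::finite) chart set \<Rightarrow> 'm \<Rightarrow> (('m, 'n) tangent \<Rightarrow> 'm) \<Rightarrow>
     (('m, 'n) tangent \<Rightarrow> ('m, 'n) tangent) \<Rightarrow> bool" where
  "has_differential_at_zero \<A> p \<phi> L \<longleftrightarrow>
     (\<forall>c \<in> charts_at \<A> p. \<forall>c' \<in> charts_at \<A> (\<phi> zero_tangent).
        (\<forall>\<^sub>F y in nhds 0. \<phi> (tangent_vec \<A> c p y) \<in> fst c') \<and>
        ((snd c' \<circ> \<phi> \<circ> tangent_vec \<A> c p) has_derivative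
           (tangent_coord c' \<circ> L \<circ> tangent_vec \<A> c p)) (at 0))"

text \<open>
  The inner product on \<open>T\<^sub>pM\<close> is pulled back from \<open>real^'n\<close> by an arbitrarily chosen chart around \<open>p\<close>.
  The choice is immaterial: see \<open>tangent_newton_chart_independent\<close>.
\<close>

definition some_chart :: "('m::topological_space, 'n::finite) chart set \<Rightarrow> 'm \<Rightarrow> ('m, 'n) chart" where
  "some_chart \<A> p = (SOME c. c \<in> charts_at \<A> p)"

definition tangent_newton_defined ::
    "('m::topological_space, 'n::finite) chart set \<Rightarrow> 'm \<Rightarrow> (('m, 'n) tangent \<Rightarrow> real) \<Rightarrow>
     ('m, 'n) tangent \<Rightarrow> bool" where
  "tangent_newton_defined \<A> p g v \<longleftrightarrow>
     (let c = some_chart \<A> p in newton_defined (g \<circ> tangent_vec \<A> c p) (tangent_coord c v))"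

definition tangent_newton ::
    "('m::topological_space, 'n::finite) chart set \<Rightarrow> 'm \<Rightarrow> (('m, 'n) tangent \<Rightarrow> real) \<Rightarrow>
     ('m, 'n) tangent \<Rightarrow> ('m, 'n) tangent" where
  "tangent_newton \<A> p g v =
     (let c = some_chart \<A> p
      in tangent_vec \<A> c p (newton (g \<circ> tangent_vec \<A> c p) (tangent_coord c v)))"

text \<open>
  A path-dependent iteration maps \<open>k\<close>, the past iterates \<open>[p\<^sub>0, \<dots>, p\<^bsub>k-1\<^esub>]\<close> and the current iterate
  \<open>p\<^sub>k\<close> to \<open>p\<^bsub>k+1\<^esub>\<close>, or to \<open>None\<close> if the latter is not well-defined.
\<close>

type_synonym 'm path_iteration = "nat \<Rightarrow> 'm list \<Rightarrow> 'm \<Rightarrow> 'm option"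

definition iterates :: "'m path_iteration \<Rightarrow> 'm \<Rightarrow> (nat \<Rightarrow> 'm) \<Rightarrow> bool" where
  "iterates E p0 p \<longleftrightarrow> p 0 = p0 \<and> (\<forall>k. E k (map p [0..<k]) (p k) = Some (p (Suc k)))"

definition converges_locally_quadratically ::
    "('m::topological_space, 'n::finite) chart set \<Rightarrow> 'm path_iteration \<Rightarrow> 'm \<Rightarrow> bool" where
  "converges_locally_quadratically \<A> E pstar \<longleftrightarrow>
     (\<exists>U \<phi> V \<kappa>. (U, \<phi>) \<in> charts_at \<A> pstar \<and> open V \<and> pstar \<in> V \<and> V \<subseteq> U \<and>
        (\<forall>p0\<in>V. \<exists>p. iterates E p0 p \<and> (\<forall>k. p k \<in> V) \<and> p \<longlonglongrightarrow> pstar \<and>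
           (\<forall>k. norm (\<phi> (p (Suc k)) - \<phi> pstar) \<le> \<kappa> * (norm (\<phi> (p k) - \<phi> pstar))\<^sup>2)))"

type_synonym ('m, 'n) param_pair =
  "(('m, 'n) tangent \<Rightarrow> 'm) \<times> (('m, 'n) tangent \<Rightarrow> 'm)"

definition is_selection_rule ::
    "('m \<Rightarrow> ('m, 'n::finite) param_pair set) \<Rightarrow> (nat \<Rightarrow> 'm list \<Rightarrow> 'm \<Rightarrow> ('m, 'n) param_pair) \<Rightarrow> bool" where
  "is_selection_rule \<Sigma> \<sigma> \<longleftrightarrow> (\<forall>k ps p. length ps = k \<longrightarrow> \<sigma> k ps p \<in> \<Sigma> p)"

definition path_newton ::
    "('m::topological_space, 'n::finite) chart set \<Rightarrow> ('m \<Rightarrow> real) \<Rightarrow>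
     (nat \<Rightarrow> 'm list \<Rightarrow> 'm \<Rightarrow> ('m, 'n) param_pair) \<Rightarrow> 'm path_iteration" where
  "path_newton \<A> f \<sigma> k ps p =
     (let (\<phi>, \<psi>) = \<sigma> k ps p
      in if tangent_newton_defined \<A> p (f \<circ> \<phi>) zero_tangent
         then Some (\<psi> (tangent_newton \<A> p (f \<circ> \<phi>) zero_tangent))
         else None)"

definition E0 ::
    "('m::topological_space, 'n::finite) chart set \<Rightarrow> 'm \<Rightarrow> ('m, 'n) param_pair \<Rightarrow> bool" where
  "E0 \<A> p = (\<lambda>(\<phi>, \<psi>). \<phi> zero_tangent = p \<and> \<psi> zero_tangent = p \<and>
     has_differential_at_zero \<A> p \<phi> id \<and> has_differential_at_zero \<A> p \<psi> id)"

text \<open>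
  In E1 the composition with the chart is meaningful near \<open>0\<close> because E0 makes \<open>\<phi>\<close> continuous
  at \<open>0\<^sub>p\<close>; E2 by itself has to say that \<open>\<psi>\<close> stays in the chart domain for \<open>norm y < \<rho>\<close>.
\<close>

definition E1 ::
    "('m::topological_space, 'n::finite) chart set \<Rightarrow> ('m, 'n) chart \<Rightarrow> real \<Rightarrow> 'm \<Rightarrow>
     ('m, 'n) param_pair \<Rightarrow> bool" where
  "E1 \<A> c \<alpha> p = (\<lambda>(\<phi>, \<psi>).
     \<exists>B. has_second_derivative (local_rep \<A> c p \<phi>) B 0 \<and> second_derivative_norm B \<le> \<alpha>)"

definition E2 ::
    "('m::topological_space, 'n::finite) chart set \<Rightarrow> ('m, 'n) chart \<Rightarrow> real \<Rightarrow> real \<Rightarrow> 'm \<Rightarrow>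
     ('m, 'n) param_pair \<Rightarrow> bool" where
  "E2 \<A> c \<rho> \<beta> p = (\<lambda>(\<phi>, \<psi>).
     \<forall>y. norm y < \<rho> \<longrightarrow> \<psi> (tangent_vec \<A> c p y) \<in> fst c \<and>
       norm (local_rep \<A> c p \<psi> y - snd c p - y) \<le> \<beta> * (norm y)\<^sup>2)"

definition satisfies_E0_E2 ::
    "('m::topological_space, 'n::finite) chart set \<Rightarrow> ('m \<Rightarrow> ('m, 'n) param_pair set) \<Rightarrow> bool" where
  "satisfies_E0_E2 \<A> \<Sigma> \<longleftrightarrow> (\<forall>p. \<Sigma> p \<noteq> {}) \<and>
     (\<forall>q. \<exists>U \<phi> \<rho> \<alpha> \<beta>. (U, \<phi>) \<in> charts_at \<A> q \<and> \<phi> q = 0 \<and> \<rho> > 0 \<and>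
        (\<forall>p\<in>U. \<forall>s \<in> \<Sigma> p. E0 \<A> p s \<and> E1 \<A> (U, \<phi>) \<alpha> p s \<and> E2 \<A> (U, \<phi>) \<rho> \<beta> p s))"

lemma transition_factor:
  assumes "is_chart c" "is_chart c'" "p \<in> fst c" "p \<in> fst c'"
  obtains S where "open S" "snd c p \<in> S"
    "\<And>x. x \<in> S \<Longrightarrow> (transition c' c'' \<circ> transition c c') x = transition c c'' x"
proof -
  let ?S = "snd c ` fst c \<inter> chart_inv c -` fst c'"
  have h: "homeomorphism (fst c) (snd c ` fst c) (snd c) (chart_inv c)"
    and o: "open (snd c ` fst c)" and o': "open (fst c')"
    using assms by (auto simp: is_chart_def)
  have "open ?S"
    using h o o' by (auto simp: homeomorphism_def intro!: continuous_open_preimage)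
  moreover have "chart_inv c (snd c p) = p"
    using h assms(3) by (auto simp: homeomorphism_def)
  then have "snd c p \<in> ?S" using assms by auto
  moreover have "(transition c' c'' \<circ> transition c c') x = transition c c'' x" if "x \<in> ?S" for x
    using that assms(2) by (auto simp: transition_def is_chart_def homeomorphism_def)
  ultimately show ?thesis using that by blast
qed

lemma transition_at:
  assumes "is_chart c" "p \<in> fst c"
  shows "transition c c' (snd c p) = snd c' p"
  using assms by (auto simp: transition_def is_chart_def homeomorphism_def)

lemma transition_differentiable:
  assumes "C2_manifold \<A>" "c \<in> charts_at \<A> p" "c' \<in> charts_at \<A> p"
  shows "transition c c' differentiable (at (snd c p))"
proof -
  obtain a where a: "a \<in> \<A>" "p \<in> fst a"
    using assms(1) unfolding C2_manifold_def by blast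
  have ch: "is_chart a" "is_chart c" "is_chart c'" "p \<in> fst c" "p \<in> fst c'"
    and comp: "C2_compatible a c" "C2_compatible a c'"
    using a assms by (auto simp: C2_manifold_def charts_at_def C2_charts_def)
  have 1: "transition c a differentiable (at (snd c p))"
    using comp(1) a ch unfolding C2_compatible_def C2_on_def differentiable_def
    by (meson IntI imageI)
  have 2: "transition a c' differentiable (at (snd a p))"
    using comp(2) a ch unfolding C2_compatible_def C2_on_def differentiable_def
    by (meson IntI imageI)
  obtain S where S: "open S" "snd c p \<in> S"
    "\<And>x. x \<in> S \<Longrightarrow> (transition a c' \<circ> transition c a) x = transition c c' x"
    using transition_factor ch a by metis
  have "(transition a c' \<circ> transition c a) differentiable (at (snd c p))"
    using 1 2 ch by (intro differentiable_chain_at) (auto simp: transition_at)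
  then obtain D where "((transition a c' \<circ> transition c a) has_derivative D) (at (snd c p))"
    unfolding differentiable_def by blast
  from has_derivative_transform_within_open[OF this S] show ?thesis
    unfolding differentiable_def by blast
qed

lemma transition_derivative_compose:
  assumes "C2_manifold \<A>" "c \<in> charts_at \<A> p" "c' \<in> charts_at \<A> p" "c'' \<in> charts_at \<A> p"
  shows "frechet_derivative (transition c c'') (at (snd c p)) y =
    frechet_derivative (transition c' c'') (at (snd c' p))
      (frechet_derivative (transition c c') (at (snd c p)) y)"
proof -
  have ch: "is_chart c" "is_chart c'" "p \<in> fst c" "p \<in> fst c'"
    using assms by (auto simp: charts_at_def C2_charts_def)
  obtain S where S: "open S" "snd c p \<in> S"
    "\<And>x. x \<in> S \<Longrightarrow> (transition c' c'' \<circ> transition c c') x = transition c c'' x"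
    using transition_factor ch by metis
  have "((transition c' c'' \<circ> transition c c') has_derivative
      (frechet_derivative (transition c' c'') (at (snd c' p)) \<circ>
       frechet_derivative (transition c c') (at (snd c p)))) (at (snd c p))"
  proof (rule diff_chain_at)
    show "(transition c c' has_derivative frechet_derivative (transition c c') (at (snd c p))) (at (snd c p))"
      using transition_differentiable[OF assms(1,2,3)] by (simp only: frechet_derivative_works)
    show "(transition c' c'' has_derivative frechet_derivative (transition c' c'') (at (snd c' p)))
        (at (transition c c' (snd c p)))"
      using transition_differentiable[OF assms(1,3,4)] ch
      by (simp only: frechet_derivative_works transition_at)
  qed
  then have "(transition c c'' has_derivative
      (frechet_derivative (transition c' c'') (at (snd c' p)) \<circ>
       frechet_derivative (transition c c') (at (snd c p)))) (at (snd c p))"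
    using S by (rule has_derivative_transform_within_open)
  from fun_cong[OF frechet_derivative_at[OF this], of y] show ?thesis by simp
qed

lemma transition_derivative_self:
  assumes "c \<in> charts_at \<A> p"
  shows "frechet_derivative (transition c c) (at (snd c p)) y = y"
proof -
  have ch: "is_chart c" "p \<in> fst c"
    using assms by (auto simp: charts_at_def C2_charts_def)
  have "(transition c c has_derivative (\<lambda>y. y)) (at (snd c p))"
  proof (rule has_derivative_transform_within_open[of "\<lambda>y. y"])
    show "open (snd c ` fst c)" "snd c p \<in> snd c ` fst c" using ch by (auto simp: is_chart_def)
    show "x = transition c c x" if "x \<in> snd c ` fst c" for x
      using that ch by (auto simp: transition_at)
  qed (rule has_derivative_ident)
  from fun_cong[OF frechet_derivative_at[OF this], of y] show ?thesis by simp
qed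

lemma tangent_space_transform:
  assumes "v \<in> tangent_space \<A> p" "c \<in> charts_at \<A> p" "c' \<in> charts_at \<A> p"
  shows "v c' = frechet_derivative (transition c c') (at (snd c p)) (v c)"
  using assms unfolding tangent_space_def by blast

lemma bij_betw_tangent_coord:
  assumes "C2_manifold \<A>" "c \<in> charts_at \<A> p"
  shows "bij_betw (tangent_coord c) (tangent_space \<A> p) UNIV"
proof (rule bij_betw_imageI)
  show "inj_on (tangent_coord c) (tangent_space \<A> p)"
  proof (rule inj_onI, rule ext)
    fix v w c'
    assume v: "v \<in> tangent_space \<A> p" and w: "w \<in> tangent_space \<A> p"
      and eq: "tangent_coord c v = tangent_coord c w"
    show "v c' = w c'"
    proof (cases "c' \<in> charts_at \<A> p")
      case True
      then show ?thesis
        using tangent_space_transform[OF v assms(2) True] tangent_space_transform[OF w assms(2) True] eq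
        by (simp only: tangent_coord_def)
    next
      case False
      then have "v c' = 0" "w c' = 0" using v w unfolding tangent_space_def by blast+
      then show ?thesis by simp
    qed
  qed
  show "tangent_coord c ` tangent_space \<A> p = UNIV"
  proof (intro equalityI subset_UNIV subsetI)
    fix y :: "real^'b"
    define v where "v = (\<lambda>c'. if c' \<in> charts_at \<A> p
      then frechet_derivative (transition c c') (at (snd c p)) y else 0)"
    have v: "v c' = frechet_derivative (transition c c') (at (snd c p)) y" if "c' \<in> charts_at \<A> p" for c'
      using that by (simp only: v_def if_True)
    have "v \<in> tangent_space \<A> p"
      unfolding tangent_space_def
    proof (intro CollectI conjI allI impI ballI)
      show "v d = 0" if "d \<notin> charts_at \<A> p" for d
        using that by (simp only: v_def if_False)
      show "v d' = frechet_derivative (transition d d') (at (snd d p)) (v d)"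
        if d: "d \<in> charts_at \<A> p" "d' \<in> charts_at \<A> p" for d d'
        unfolding v[OF d(1)] v[OF d(2)] by (rule transition_derivative_compose[OF assms d])
    qed
    moreover have "tangent_coord c v = y"
      unfolding tangent_coord_def v[OF assms(2)] by (rule transition_derivative_self[OF assms(2)])
    ultimately show "y \<in> tangent_coord c ` tangent_space \<A> p" by blast
  qed
qed

lemma tangent_vec_in_space:
  assumes "C2_manifold \<A>" "c \<in> charts_at \<A> p"
  shows "tangent_vec \<A> c p y \<in> tangent_space \<A> p"
  using bij_betw_tangent_coord[OF assms]
  by (simp add: tangent_vec_def bij_betw_def inv_into_into)

lemma tangent_coord_vec:
  assumes "C2_manifold \<A>" "c \<in> charts_at \<A> p"
  shows "tangent_coord c (tangent_vec \<A> c p y) = y"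
  using bij_betw_tangent_coord[OF assms]
  by (simp add: tangent_vec_def bij_betw_def f_inv_into_f)

lemma tangent_vec_coord:
  assumes "C2_manifold \<A>" "c \<in> charts_at \<A> p" "v \<in> tangent_space \<A> p"
  shows "tangent_vec \<A> c p (tangent_coord c v) = v"
  using bij_betw_tangent_coord[OF assms(1,2)] assms(3)
  by (simp add: tangent_vec_def bij_betw_def)

lemma tangent_vec_change:
  assumes "C2_manifold \<A>" "c \<in> charts_at \<A> p" "c' \<in> charts_at \<A> p"
  shows "tangent_vec \<A> c p y =
    tangent_vec \<A> c' p (frechet_derivative (transition c c') (at (snd c p)) y)"
proof -
  have "tangent_coord c' (tangent_vec \<A> c p y) =
      frechet_derivative (transition c c') (at (snd c p)) (tangent_coord c (tangent_vec \<A> c p y))"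
    unfolding tangent_coord_def
    by (rule tangent_space_transform[OF tangent_vec_in_space[OF assms(1,2)] assms(2,3)])
  then show ?thesis
    using tangent_coord_vec[OF assms(1,2)] tangent_vec_coord[OF assms(1,3)]
      tangent_vec_in_space[OF assms(1,2)] by metis
qed

lemma gradient_eqI: "GDERIV g x :> D \<Longrightarrow> gradient g x = D"
  unfolding gradient_def
proof (rule the_equality)
  fix D' assume "GDERIV g x :> D" "GDERIV g x :> D'"
  then have "(\<lambda>h. inner h D) = (\<lambda>h. inner h D')"
    unfolding gderiv_def by (rule has_derivative_unique)
  then have "\<forall>h. inner h D = inner h D'" by (rule fun_cong[THEN allI])
  then show "D' = D" by (simp add: vector_eq_ldot)
qed

lemma eventually_has_derivative_transform:
  assumes "(f has_derivative D) (at x)" "\<forall>\<^sub>F y in nhds x. f y = g y"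
  shows "(g has_derivative D) (at x)"
proof -
  obtain S where S: "open S" "x \<in> S" and eq: "\<And>y. y \<in> S \<Longrightarrow> f y = g y"
    using assms(2) unfolding eventually_nhds by blast
  show ?thesis by (rule has_derivative_transform_within_open[OF assms(1) S eq])
qed

lemma matrix_inv_inverse:
  fixes M :: "real^'n^'n"
  assumes "invertible M"
  shows "M ** matrix_inv M = mat 1" "matrix_inv M ** M = mat 1"
  using someI_ex[OF assms[unfolded invertible_def]] unfolding matrix_inv_def by auto

lemma has_gradient:
  assumes "(g has_derivative blinfun_apply (g' :: (real^'n) \<Rightarrow>\<^sub>L real)) (at x)"
  shows "GDERIV g x :> (\<chi> i. g' (axis i 1))"
proof -
  have "g' h = inner h (\<chi> i. g' (axis i 1))" for h
  proof -
    have "g' h = g' (\<Sum>i\<in>UNIV. h $ i *\<^sub>R axis i 1)"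
      using basis_expansion[of h] by (simp add: scalar_mult_eq_scaleR)
    also have "\<dots> = inner h (\<chi> i. g' (axis i 1))"
      by (simp add: blinfun.sum_right blinfun.scaleR_right inner_vec_def)
    finally show ?thesis .
  qed
  then have "blinfun_apply g' = (\<lambda>h. inner h (\<chi> i. g' (axis i 1)))" by (rule ext)
  from subst[where P = "\<lambda>D. (g has_derivative D) (at x)", OF this assms]
  show ?thesis unfolding gderiv_def .
qed

lemma has_second_derivative_hessian:
  fixes g :: "real^'n \<Rightarrow> real"
  assumes "has_second_derivative g B x"
  shows "\<forall>\<^sub>F y in nhds x. GDERIV g y :> gradient g y"
    and "(gradient g has_derivative (\<lambda>h. hessian g x *v h)) (at x)"
proof -
  obtain g' where g': "\<forall>\<^sub>F y in nhds x. (g has_derivative blinfun_apply (g' y)) (at y)"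
    and B: "(g' has_derivative blinfun_apply B) (at x)"
    using assms unfolding has_second_derivative_def by blast
  have *: "\<forall>\<^sub>F y in nhds x. GDERIV g y :> (\<chi> i. g' y (axis i 1))"
    using g' by eventually_elim (rule has_gradient)
  then show "\<forall>\<^sub>F y in nhds x. GDERIV g y :> gradient g y"
    by eventually_elim (use gradient_eqI in metis)
  have grad: "\<forall>\<^sub>F y in nhds x. (\<chi> i. g' y (axis i 1)) = gradient g y"
    using * by eventually_elim (use gradient_eqI in metis)
  have "((\<lambda>y. g' y (axis i 1)) has_derivative (\<lambda>h. B h (axis i 1))) (at x)" for i
    using bounded_linear.has_derivative[OF
        bounded_bilinear.bounded_linear_left[OF bounded_bilinear_blinfun_apply] B] .
  then have "((\<lambda>y. \<chi> i. g' y (axis i 1)) has_derivative (\<lambda>h. \<chi> i. B h (axis i 1))) (at x)"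
    by (auto simp: has_derivative_componentwise_within[of "\<lambda>y. \<chi> i. g' y (axis i 1)"]
        Basis_vec_def inner_axis)
  from eventually_has_derivative_transform[OF this grad]
  have "(gradient g has_derivative (\<lambda>h. \<chi> i. B h (axis i 1))) (at x)" .
  then have "gradient g differentiable (at x)" unfolding differentiable_def by blast
  then show "(gradient g has_derivative (\<lambda>h. hessian g x *v h)) (at x)"
    unfolding hessian_def by (simp add: jacobian_works)
qed

lemma newton_linear_change:
  fixes g :: "real^'n \<Rightarrow> real" and P :: "real^'n^'n"
  assumes "invertible P" and nd: "newton_defined g (P *v y)"
  shows "newton_defined (g \<circ> (*v) P) y"
    and "P *v newton (g \<circ> (*v) P) y = newton g (P *v y)"
proof -
  let ?H = "hessian g (P *v y)" and ?h = "g \<circ> (*v) P"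
  obtain B where B: "has_second_derivative g B (P *v y)" and H: "invertible ?H"
    using nd unfolding newton_defined_def by blast
  obtain g' where g': "\<forall>\<^sub>F z in nhds (P *v y). (g has_derivative blinfun_apply (g' z)) (at z)"
    and B': "(g' has_derivative blinfun_apply B) (at (P *v y))"
    using B unfolding has_second_derivative_def by blast
  define L where "L = Blinfun ((*v) P)"
  have L: "blinfun_apply L = (*v) P"
    unfolding L_def by (rule bounded_linear_Blinfun_apply) (rule matrix_vector_mul_bounded_linear)
  have dP: "((*v) P has_derivative (*v) P) (at z)" for z
    by (rule bounded_linear_imp_has_derivative) (rule matrix_vector_mul_bounded_linear)
  have lim: "filterlim ((*v) P) (nhds (P *v y)) (nhds y)"
    using has_derivative_continuous[OF dP] by (simp add: tendsto_nhds_iff isCont_def)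
  have h1: "\<forall>\<^sub>F z in nhds y. (?h has_derivative blinfun_apply (g' (P *v z) o\<^sub>L L)) (at z)"
    using eventually_compose_filterlim[OF g' lim]
  proof eventually_elim
    case (elim z)
    show ?case using diff_chain_at[OF dP elim] by (simp add: L blinfun_compose.rep_eq)
  qed
  have h2: "((\<lambda>z. g' (P *v z) o\<^sub>L L) has_derivative (\<lambda>v. blinfun_apply B (P *v v) o\<^sub>L L)) (at y)"
    using bounded_linear.has_derivative[OF
        bounded_bilinear.bounded_linear_left[OF bounded_bilinear_blinfun_compose]
        diff_chain_at[OF dP B']] by (simp add: o_def)
  define C where "C = Blinfun (\<lambda>v. blinfun_apply B (P *v v) o\<^sub>L L)"
  have C: "blinfun_apply C = (\<lambda>v. blinfun_apply B (P *v v) o\<^sub>L L)"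
    unfolding C_def using has_derivative_bounded_linear[OF h2] by (rule bounded_linear_Blinfun_apply)
  have sd: "has_second_derivative ?h C y"
    unfolding has_second_derivative_def C
    by (rule exI[of _ "\<lambda>z. g' (P *v z) o\<^sub>L L"]) (intro conjI h1 h2)

  note gr = has_second_derivative_hessian[OF B]
  have grad: "\<forall>\<^sub>F z in nhds y. gradient ?h z = transpose P *v gradient g (P *v z)"
    using eventually_compose_filterlim[OF gr(1) lim]
  proof eventually_elim
    case (elim z)
    then have "(?h has_derivative ((\<lambda>v. inner v (gradient g (P *v z))) \<circ> (*v) P)) (at z)"
      unfolding gderiv_def by (intro diff_chain_at dP)
    then have "GDERIV ?h z :> transpose P *v gradient g (P *v z)"
      unfolding gderiv_def
      by (simp add: o_def inner_commute[of _ "gradient g _"] inner_commute[of _ "_ v* _"]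
          dot_lmul_matrix)
    then show ?case by (rule gradient_eqI)
  qed
  have "((\<lambda>z. transpose P *v gradient g (P *v z)) has_derivative
      (\<lambda>v. transpose P *v (?H *v (P *v v)))) (at y)"
    using bounded_linear.has_derivative[OF matrix_vector_mul_bounded_linear[of "transpose P"]
        diff_chain_at[OF dP gr(2)]]
    by (simp only: o_def)
  moreover have "\<forall>\<^sub>F z in nhds y. transpose P *v gradient g (P *v z) = gradient ?h z"
    using grad by eventually_elim (rule sym)
  ultimately have "(gradient ?h has_derivative (\<lambda>v. transpose P *v (?H *v (P *v v)))) (at y)"
    by (rule eventually_has_derivative_transform)
  from has_derivative_unique[OF this has_second_derivative_hessian(2)[OF sd]]
  have hv: "hessian ?h y *v v = transpose P *v (?H *v (P *v v))" for v
    by metis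
  then have hess: "hessian ?h y = transpose P ** ?H ** P"
    unfolding matrix_eq by (intro allI) (simp only: matrix_vector_mul_assoc matrix_mul_assoc)
  have inv: "invertible (hessian ?h y)"
    unfolding hess using assms(1) H by (intro invertible_mult transpose_invertible)
  show "newton_defined ?h y"
    unfolding newton_defined_def using sd inv by blast

  let ?n = "matrix_inv (hessian ?h y) *v gradient ?h y"
  have "transpose P *v (?H *v (P *v ?n)) = hessian ?h y *v ?n" by (rule hv[symmetric])
  also have "\<dots> = gradient ?h y"
    using inv by (simp add: matrix_vector_mul_assoc matrix_inv_inverse(1))
  also have "\<dots> = transpose P *v gradient g (P *v y)"
    using grad by (rule eventually_nhds_x_imp_x)
  finally have "?H *v (P *v ?n) = gradient g (P *v y)"
    using transpose_invertible[OF assms(1)]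
    by (metis inj_matrix_vector_mult injD)
  then have "P *v ?n = matrix_inv ?H *v gradient g (P *v y)"
    using H by (metis matrix_inv_inverse(2) matrix_vector_mul_assoc matrix_vector_mul_lid)
  then show "P *v newton ?h y = newton g (P *v y)"
    unfolding newton_def by (simp add: matrix_vector_mult_diff_distrib)
qed

lemma chart_newton_change:
  assumes "C2_manifold \<A>" "c \<in> charts_at \<A> p" "c' \<in> charts_at \<A> p" "v \<in> tangent_space \<A> p"
    and "newton_defined (g \<circ> tangent_vec \<A> c' p) (tangent_coord c' v)"
  shows "newton_defined (g \<circ> tangent_vec \<A> c p) (tangent_coord c v)"
    and "tangent_vec \<A> c p (newton (g \<circ> tangent_vec \<A> c p) (tangent_coord c v)) =
         tangent_vec \<A> c' p (newton (g \<circ> tangent_vec \<A> c' p) (tangent_coord c' v))"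
proof -
  let ?D = "\<lambda>c c'. frechet_derivative (transition c c') (at (snd c p))"
  define P where "P = matrix (?D c c')"
  have lin: "linear (?D a b)" if "a \<in> charts_at \<A> p" "b \<in> charts_at \<A> p" for a b
    using linear_frechet_derivative transition_differentiable[OF assms(1) that] by blast
  have P: "P *v y = ?D c c' y" for y
    unfolding P_def using lin[OF assms(2,3)] by (simp add: matrix_works)
  have "P *v (matrix (?D c' c) *v y) = y" for y
    using transition_derivative_compose[OF assms(1,3,2,3)] transition_derivative_self[OF assms(3)]
    by (simp add: P matrix_works lin assms(2,3))
  then have "P ** matrix (?D c' c) = mat 1"
    by (simp add: matrix_eq matrix_vector_mul_assoc)
  then have inv: "invertible P"
    using invertible_right_inverse by blast
  have comp: "g \<circ> tangent_vec \<A> c p = (g \<circ> tangent_vec \<A> c' p) \<circ> (*v) P"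
    using tangent_vec_change[OF assms(1,2,3)] by (simp add: o_def P)
  have "tangent_coord c' v = P *v tangent_coord c v"
    unfolding tangent_coord_def P by (rule tangent_space_transform[OF assms(4,2,3)])
  with newton_linear_change[OF inv, of "g \<circ> tangent_vec \<A> c' p" "tangent_coord c v"] assms(5)
  show "newton_defined (g \<circ> tangent_vec \<A> c p) (tangent_coord c v)"
    and "tangent_vec \<A> c p (newton (g \<circ> tangent_vec \<A> c p) (tangent_coord c v)) =
         tangent_vec \<A> c' p (newton (g \<circ> tangent_vec \<A> c' p) (tangent_coord c' v))"
    by (simp_all add: comp tangent_vec_change[OF assms(1,2,3)] P[symmetric])
qed

lemma tangent_newton_chart_independent:
  assumes "C2_manifold \<A>" "c \<in> charts_at \<A> p" "v \<in> tangent_space \<A> p"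
  shows "tangent_newton_defined \<A> p g v \<longleftrightarrow>
      newton_defined (g \<circ> tangent_vec \<A> c p) (tangent_coord c v)"
    and "tangent_newton_defined \<A> p g v \<Longrightarrow> tangent_newton \<A> p g v =
      tangent_vec \<A> c p (newton (g \<circ> tangent_vec \<A> c p) (tangent_coord c v))"
proof -
  have s: "some_chart \<A> p \<in> charts_at \<A> p"
    unfolding some_chart_def using assms(2) by (rule someI)
  show eq: "tangent_newton_defined \<A> p g v \<longleftrightarrow>
      newton_defined (g \<circ> tangent_vec \<A> c p) (tangent_coord c v)"
    unfolding tangent_newton_defined_def Let_def
    using chart_newton_change(1)[OF assms(1) _ _ assms(3)] s assms(2) by blast
  show "tangent_newton_defined \<A> p g v \<Longrightarrow> tangent_newton \<A> p g v =
      tangent_vec \<A> c p (newton (g \<circ> tangent_vec \<A> c p) (tangent_coord c v))"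
    unfolding eq tangent_newton_def Let_def
    by (rule chart_newton_change(2)[OF assms(1) s assms(2,3)])
qed

end

theory Submission
  imports Defs
begin

text \<open>
  Write \<open>F = f \<circ> \<phi>\<inverse>\<close> for the function in a chart with \<open>\<phi> pstar = 0\<close>. Everything rests on one estimate for
  the Newton equation: \<open>\<parallel>F''(x) x - F'(x)\<parallel> \<le> C \<parallel>x\<parallel>\<^sup>2\<close> near \<open>0\<close>, that is, the critical point \<open>0\<close> solves
  the linearised equation \<open>F''(x) v = - F'(x)\<close>, \<open>v = - x\<close>, up to second order
  (\<open>newton_consistent\<close>).

  In the chart \<open>\<phi>0\<close> this follows from the radial bound on the Hessian by integrating along rays
  (\<open>radial_hessian_bound_imp_newton_consistent\<close>). The conditions E1 and E2 speak of another chart,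
  so the estimate has to be transported. It is invariant under \<open>C\<^sup>2\<close> changes of coordinates
  (\<open>newton_consistent_compose\<close>), because the terms that a second derivative of the coordinate change
  produces are multiplied by \<open>F' = O(\<parallel>x\<parallel>)\<close>.

  For the same reason a parametrisation \<open>h\<close> with \<open>h 0 = x\<close>, \<open>Dh(0) = I\<close> and \<open>D\<^sup>2h(0)\<close> bounded
  changes the Newton system at \<open>x\<close> only by \<open>O(\<parallel>x\<parallel>)\<close> in the matrix: the system stays uniformly
  invertible and its solution \<open>y\<close> satisfies \<open>x + y = O(\<parallel>x\<parallel>\<^sup>2)\<close> (\<open>newton_step_quadratic\<close>). Condition E1
  controls only the quadratic form of \<open>D\<^sup>2h(0)\<close>; as a second derivative is symmetric, polarisation
  turns this into a bound on the bilinear map (\<open>norm_le_second_derivative_norm\<close>). By E2 the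
  next iterate has coordinates \<open>x + y + O(\<parallel>y\<parallel>\<^sup>2) = O(\<parallel>x\<parallel>\<^sup>2)\<close>. All constants are uniform over the
  admissible pairs, so the choices made along the path are irrelevant, and a sequence of such steps
  started close enough to \<open>pstar\<close> stays there and converges
  (\<open>quadratic_steps_imp_converges_locally_quadratically\<close>).
\<close>

section \<open>Second derivatives\<close>

text \<open>
  The second difference over a small parallelogram approximates \<open>D\<^sup>2h(x)(w, v)\<close>. Being symmetric in
  \<open>v\<close> and \<open>w\<close>, it forces the symmetry of the second derivative. The second derivative is given at the
  single point \<open>x\<close>, as in E1, so the error is controlled by the expansion of \<open>h'\<close> at \<open>x\<close>.
\<close>

lemma second_difference_quotient:
  fixes h :: "'a::real_normed_vector \<Rightarrow> 'b::real_normed_vector"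
  assumes h': "\<forall>\<^sub>F y in nhds x. (h has_derivative blinfun_apply (h' y)) (at y)"
    and B: "(h' has_derivative blinfun_apply B) (at x)"
    and "e > 0"
  shows "\<exists>d>0. \<forall>s. 0 < s \<and> s < d \<longrightarrow>
    norm (h (x + s *\<^sub>R v + s *\<^sub>R w) - h (x + s *\<^sub>R v) - h (x + s *\<^sub>R w) + h x - s\<^sup>2 *\<^sub>R B w v) \<le> e * s\<^sup>2"
proof -
  \<comment> \<open>The coefficient that the error term picks up below; adding \<open>1\<close> makes it positive.\<close>
  define K where "K = (norm w + 2 * norm v) * norm v + 1"
  have K: "K > 0" unfolding K_def by (simp add: add_nonneg_pos)
  obtain d1 where d1: "d1 > 0" "\<And>y. dist y x < d1 \<Longrightarrow> (h has_derivative blinfun_apply (h' y)) (at y)"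
    using h' unfolding eventually_nhds_metric by blast
  have eK: "e / K > 0" using \<open>e > 0\<close> K by simp
  obtain d2 where d2: "d2 > 0"
    "\<And>y. norm (y - x) < d2 \<Longrightarrow> norm (h' y - h' x - B (y - x)) \<le> e / K * norm (y - x)"
    using B eK unfolding has_derivative_at_alt by blast
  define N where "N = norm v + norm w + 1"
  have N: "N > 0" unfolding N_def by (simp add: add_nonneg_pos)
  define d where "d = min d1 d2 / N"
  have "norm (h (x + s *\<^sub>R v + s *\<^sub>R w) - h (x + s *\<^sub>R v) - h (x + s *\<^sub>R w) + h x - s\<^sup>2 *\<^sub>R B w v)
      \<le> e * s\<^sup>2" if s: "0 < s" "s < d" for s
  proof -
    have sN: "s * N < d1" "s * N < d2"
      using s N by (auto simp: d_def pos_less_divide_eq)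
    \<comment> \<open>\<open>G s - G 0\<close> is the quantity to be bounded, so a bound on the derivative of \<open>G\<close> suffices.\<close>
    define G where "G t = h (x + (s *\<^sub>R w + t *\<^sub>R v)) - h (x + t *\<^sub>R v) - (t * s) *\<^sub>R B w v" for t
    have le1: "norm (s *\<^sub>R w + t *\<^sub>R v) \<le> s * (norm w + norm v)"
      and le2: "norm (t *\<^sub>R v) \<le> s * norm v" if "t \<in> {0..s}" for t
    proof -
      show le2: "norm (t *\<^sub>R v) \<le> s * norm v"
        using that s by (auto intro: mult_right_mono)
      show "norm (s *\<^sub>R w + t *\<^sub>R v) \<le> s * (norm w + norm v)"
        using norm_triangle_ineq[of "s *\<^sub>R w" "t *\<^sub>R v"] le2 s by (simp add: distrib_left)
    qed
    have lt: "norm (s *\<^sub>R w + t *\<^sub>R v) < min d1 d2" "norm (t *\<^sub>R v) < min d1 d2" if "t \<in> {0..s}" for t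
    proof -
      have "s * (norm w + norm v) < s * N" "s * norm v < s * N"
        using s by (auto simp: N_def intro!: mult_strict_left_mono add_nonneg_pos)
      then show "norm (s *\<^sub>R w + t *\<^sub>R v) < min d1 d2" "norm (t *\<^sub>R v) < min d1 d2"
        using le1[OF that] le2[OF that] sN by auto
    qed
    have "norm (G s - G 0) \<le> (e / K * s * (norm w + 2 * norm v) * norm v) * norm (s - 0)"
    proof (rule differentiable_bound)
      fix t assume t: "t \<in> {0..s}"
      let ?G' = "\<lambda>dt. dt *\<^sub>R (h' (x + (s *\<^sub>R w + t *\<^sub>R v)) v - h' (x + t *\<^sub>R v) v - s *\<^sub>R B w v)"
      have a1: "(h has_derivative blinfun_apply (h' (x + (s *\<^sub>R w + t *\<^sub>R v)))) (at (x + (s *\<^sub>R w + t *\<^sub>R v)))"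
        and a2: "(h has_derivative blinfun_apply (h' (x + t *\<^sub>R v))) (at (x + t *\<^sub>R v))"
        using lt[OF t] by (auto intro!: d1(2) simp: dist_norm)
      have "((\<lambda>t. h (x + (s *\<^sub>R w + t *\<^sub>R v))) has_derivative (\<lambda>dt. h' (x + (s *\<^sub>R w + t *\<^sub>R v)) (dt *\<^sub>R v))) (at t)"
        by (rule has_derivative_compose[where g = h and f = "\<lambda>t. x + (s *\<^sub>R w + t *\<^sub>R v)", OF _ a1]) (auto intro!: derivative_eq_intros)
      moreover have "((\<lambda>t. h (x + t *\<^sub>R v)) has_derivative (\<lambda>dt. h' (x + t *\<^sub>R v) (dt *\<^sub>R v))) (at t)"
        by (rule has_derivative_compose[where g = h and f = "\<lambda>t. x + t *\<^sub>R v", OF _ a2]) (auto intro!: derivative_eq_intros)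
      ultimately have "(G has_derivative ?G') (at t)"
        unfolding G_def by (auto intro!: derivative_eq_intros simp: blinfun.scaleR_right algebra_simps)
      then show "(G has_derivative ?G') (at t within {0..s})" by (rule has_derivative_at_withinI)
      \<comment> \<open>The linear parts of the two values of \<open>h'\<close> combine to \<open>s *\<^sub>R B w v\<close>; the remainders stay.\<close>
      define R where "R u = h' (x + u) - h' x - B u" for u
      have R: "norm (R u) \<le> e / K * norm u" if "norm u < min d1 d2" for u
        using d2(2)[of "x + u"] that by (simp add: R_def)
      have eq: "h' (x + (s *\<^sub>R w + t *\<^sub>R v)) v - h' (x + t *\<^sub>R v) v - s *\<^sub>R B w v
          = (R (s *\<^sub>R w + t *\<^sub>R v) - R (t *\<^sub>R v)) v"
        by (simp add: R_def blinfun.bilinear_simps)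
      have "norm (R (s *\<^sub>R w + t *\<^sub>R v) - R (t *\<^sub>R v)) \<le> e / K * norm (s *\<^sub>R w + t *\<^sub>R v) + e / K * norm (t *\<^sub>R v)"
        using norm_triangle_ineq4 R[OF lt(1)[OF t]] R[OF lt(2)[OF t]] by (meson add_mono order_trans)
      also have "\<dots> \<le> e / K * (s * (norm w + norm v)) + e / K * (s * norm v)"
        using le1[OF t] le2[OF t] eK by (intro add_mono mult_left_mono) auto
      also have "\<dots> = e / K * s * (norm w + 2 * norm v)" by (simp add: algebra_simps)
      finally have "norm ((R (s *\<^sub>R w + t *\<^sub>R v) - R (t *\<^sub>R v)) v) \<le> e / K * s * (norm w + 2 * norm v) * norm v"
        using norm_blinfun[of "R (s *\<^sub>R w + t *\<^sub>R v) - R (t *\<^sub>R v)" v]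
        by (meson mult_right_mono norm_ge_zero order_trans)
      then have "norm (dt *\<^sub>R (R (s *\<^sub>R w + t *\<^sub>R v) - R (t *\<^sub>R v)) v)
          \<le> e / K * s * (norm w + 2 * norm v) * norm v * norm dt" for dt :: real
        unfolding norm_scaleR real_norm_def
        by (subst mult.commute) (rule mult_right_mono[OF _ abs_ge_zero])
      then show "onorm ?G' \<le> e / K * s * (norm w + 2 * norm v) * norm v"
        unfolding eq by (rule onorm_le)
    qed (use s in auto)
    also have "\<dots> = e * s\<^sup>2 * ((norm w + 2 * norm v) * norm v / K)"
      using s by (simp add: power2_eq_square)
    also have "\<dots> \<le> e * s\<^sup>2 * 1"
      using \<open>e > 0\<close> K by (intro mult_left_mono) (auto simp: K_def)
    finally have "norm (G s - G 0) \<le> e * s\<^sup>2" by simp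
    moreover have "G s - G 0 =
        h (x + s *\<^sub>R v + s *\<^sub>R w) - h (x + s *\<^sub>R v) - h (x + s *\<^sub>R w) + h x - s\<^sup>2 *\<^sub>R B w v"
      by (simp add: G_def power2_eq_square algebra_simps)
    ultimately show ?thesis by simp
  qed
  moreover have "d > 0" using d1(1) d2(1) N by (simp add: d_def)
  ultimately show ?thesis by blast
qed

lemma second_derivative_symmetric:
  assumes "has_second_derivative h B x"
  shows "blinfun_apply (blinfun_apply B v) w = blinfun_apply (blinfun_apply B w) v"
proof -
  obtain h' where h': "\<forall>\<^sub>F y in nhds x. (h has_derivative blinfun_apply (h' y)) (at y)"
    and B: "(h' has_derivative blinfun_apply B) (at x)"
    using assms unfolding has_second_derivative_def by blast
  have "norm (B v w - B w v) \<le> 0 + e" if "e > 0" for e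
  proof -
    have e2: "e / 2 > 0" using that by simp
    define D where "D s = h (x + s *\<^sub>R v + s *\<^sub>R w) - h (x + s *\<^sub>R v) - h (x + s *\<^sub>R w) + h x" for s :: real
    obtain d1 where d1: "d1 > 0" "\<And>s. 0 < s \<Longrightarrow> s < d1 \<Longrightarrow> norm (D s - s\<^sup>2 *\<^sub>R B w v) \<le> e / 2 * s\<^sup>2"
      using second_difference_quotient[OF h' B e2, of v w] unfolding D_def by blast
    have D: "D s = h (x + s *\<^sub>R w + s *\<^sub>R v) - h (x + s *\<^sub>R w) - h (x + s *\<^sub>R v) + h x" for s
      by (simp add: D_def algebra_simps)
    obtain d2 where d2: "d2 > 0" "\<And>s. 0 < s \<Longrightarrow> s < d2 \<Longrightarrow> norm (D s - s\<^sup>2 *\<^sub>R B v w) \<le> e / 2 * s\<^sup>2"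
      using second_difference_quotient[OF h' B e2, of w v] unfolding D by blast
    define s where "s = min d1 d2 / 2"
    have s: "0 < s" "s < d1" "s < d2" using d1(1) d2(1) by (auto simp: s_def)
    have "s\<^sup>2 * norm (B v w - B w v) = norm ((D s - s\<^sup>2 *\<^sub>R B w v) - (D s - s\<^sup>2 *\<^sub>R B v w))"
      by (simp add: scaleR_diff_right[symmetric])
    also have "\<dots> \<le> e / 2 * s\<^sup>2 + e / 2 * s\<^sup>2"
      using d1(2)[OF s(1,2)] d2(2)[OF s(1,3)] norm_triangle_ineq4 by (meson add_mono order_trans)
    also have "\<dots> = s\<^sup>2 * e" by simp
    finally show ?thesis using s(1) by simp
  qed
  then have "norm (B v w - B w v) \<le> 0" by (rule field_le_epsilon)
  then show ?thesis by simp
qed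

text \<open>
  By symmetry, \<open>4 D\<^sup>2h(v, w) = D\<^sup>2h(v + w, v + w) - D\<^sup>2h(v - w, v - w)\<close>, and the parallelogram law
  makes the constant exactly \<open>1\<close>.
\<close>

lemma norm_le_second_derivative_norm:
  fixes h :: "'a::euclidean_space \<Rightarrow> 'b::real_normed_vector"
  assumes "has_second_derivative h B x"
  shows "norm B \<le> second_derivative_norm B"
proof -
  define S where "S = second_derivative_norm B"
  have bdd: "bdd_above ((\<lambda>\<eta>. norm (B \<eta> \<eta>)) ` sphere 0 1)"
  proof (rule bdd_aboveI2)
    fix \<eta> :: 'a assume "\<eta> \<in> sphere 0 1"
    then show "norm (B \<eta> \<eta>) \<le> norm B"
      using order_trans[OF norm_blinfun[of "B \<eta>" \<eta>]] norm_blinfun[of B \<eta>] by simp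
  qed
  have unit: "norm (B \<eta> \<eta>) \<le> S" if "norm \<eta> = 1" for \<eta>
    unfolding S_def second_derivative_norm_def using bdd that by (intro cSUP_upper) auto
  have S0: "0 \<le> S"
    using unit[of "SOME b. b \<in> Basis"] norm_ge_zero order_trans
    by (metis norm_Basis some_in_eq nonempty_Basis)
  have quad: "norm (B u u) \<le> S * (norm u)\<^sup>2" for u
  proof (cases "u = 0")
    case False
    have u: "norm u *\<^sub>R sgn u = u" using False by (simp add: sgn_div_norm)
    have "B (norm u *\<^sub>R sgn u) (norm u *\<^sub>R sgn u) = (norm u)\<^sup>2 *\<^sub>R B (sgn u) (sgn u)"
      by (simp only: blinfun.scaleR_left blinfun.scaleR_right scaleR_scaleR power2_eq_square)
    then have "B u u = (norm u)\<^sup>2 *\<^sub>R B (sgn u) (sgn u)" unfolding u .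
    then show ?thesis
      using unit[of "sgn u"] False by (simp add: norm_sgn mult.commute mult_left_mono)
  qed (simp add: S0 blinfun.zero_right)
  have pol: "norm (B v w) \<le> S" if "norm v = 1" "norm w = 1" for v w
  proof -
    have four: "(4::real) *\<^sub>R X = X + X + (X + X)" for X :: 'b
      by (simp flip: scaleR_2)
    have "4 *\<^sub>R B v w = B (v + w) (v + w) - B (v - w) (v - w)"
      using second_derivative_symmetric[OF assms, of w v]
      by (simp add: four blinfun.bilinear_simps algebra_simps)
    then have "4 * norm (B v w) = norm (B (v + w) (v + w) - B (v - w) (v - w))"
      by (metis norm_scaleR abs_numeral)
    also have "\<dots> \<le> S * (norm (v + w))\<^sup>2 + S * (norm (v - w))\<^sup>2"
      using quad norm_triangle_ineq4 by (meson add_mono order_trans)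
    also have "\<dots> = S * 4"
      using that by (simp add: power2_norm_eq_inner norm_eq_1 algebra_simps inner_commute)
    finally show ?thesis by simp
  qed
  have "norm (B v) \<le> S * norm v" for v
  proof (rule norm_blinfun_bound)
    fix w
    show "norm (B v w) \<le> S * norm v * norm w"
    proof (cases "v = 0 \<or> w = 0")
      case False
      have vw: "norm v *\<^sub>R sgn v = v" "norm w *\<^sub>R sgn w = w"
        using False by (simp_all add: sgn_div_norm)
      have "B (norm v *\<^sub>R sgn v) (norm w *\<^sub>R sgn w) = (norm v * norm w) *\<^sub>R B (sgn v) (sgn w)"
        by (simp add: blinfun.scaleR_left blinfun.scaleR_right mult.commute)
      then have "B v w = (norm v * norm w) *\<^sub>R B (sgn v) (sgn w)" unfolding vw .
      then show ?thesis
        using pol[of "sgn v" "sgn w"] False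
        by (simp add: norm_sgn mult.commute mult.left_commute mult_left_mono)
    qed (auto simp: S0 blinfun.zero_right blinfun.zero_left)
  qed (use S0 in simp)
  then have "norm B \<le> S" by (rule norm_blinfun_bound[OF S0])
  then show ?thesis by (simp add: S_def)
qed

text \<open>
  In \<open>(F \<circ> h)''(x) v = F''(h x)(h'(x) v) \<circ> h'(x) + F'(h x) \<circ> h''(x) v\<close> the last term spoils the
  invariance of the Hessian, but it carries the factor \<open>F'\<close>, which is small near a critical point.
\<close>

lemma second_order_chain_rule:
  assumes h': "\<forall>\<^sub>F y in nhds x. (h has_derivative blinfun_apply (h' y)) (at y)"
    and B: "(h' has_derivative blinfun_apply B) (at x)"
    and F': "\<forall>\<^sub>F z in nhds (h x). (F has_derivative blinfun_apply (F' z)) (at z)"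
    and A: "(F' has_derivative blinfun_apply A) (at (h x))"
  shows "\<forall>\<^sub>F y in nhds x. ((F \<circ> h) has_derivative blinfun_apply (F' (h y) o\<^sub>L h' y)) (at y)"
    and "((\<lambda>y. F' (h y) o\<^sub>L h' y) has_derivative
           (\<lambda>v. (A (h' x v) o\<^sub>L h' x) + (F' (h x) o\<^sub>L B v))) (at x)"
proof -
  have hx: "(h has_derivative blinfun_apply (h' x)) (at x)"
    using h' by (rule eventually_nhds_x_imp_x)
  have lim: "filterlim h (nhds (h x)) (nhds x)"
    using has_derivative_continuous[OF hx] by (simp add: tendsto_nhds_iff isCont_def)
  show "\<forall>\<^sub>F y in nhds x. ((F \<circ> h) has_derivative blinfun_apply (F' (h y) o\<^sub>L h' y)) (at y)"
    using eventually_compose_filterlim[OF F' lim] h'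
  proof eventually_elim
    case (elim y)
    show ?case using diff_chain_at[OF elim(2,1)] by (simp add: blinfun_compose.rep_eq)
  qed
  show "((\<lambda>y. F' (h y) o\<^sub>L h' y) has_derivative
           (\<lambda>v. (A (h' x v) o\<^sub>L h' x) + (F' (h x) o\<^sub>L B v))) (at x)"
    using bounded_bilinear.FDERIV[OF bounded_bilinear_blinfun_compose
        has_derivative_compose[OF hx A] B] by (simp add: add.commute)
qed

section \<open>The Newton equation near a critical point\<close>

text \<open>
  The last clause says that the exact step \<open>z - x\<close> solves the Newton equation at \<open>x\<close> with a residual
  of second order. At \<open>x = z\<close> it forces \<open>F' z = 0\<close>. Comparing \<open>F''\<close> with \<open>F'\<close> at the same
  point \<open>x\<close>, it transforms directly by the chain rule.
\<close>

definition newton_consistent :: "('a::real_normed_vector \<Rightarrow> real) \<Rightarrow> 'a \<Rightarrow> bool" where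
  "newton_consistent F z \<longleftrightarrow> (\<exists>S (F' :: 'a \<Rightarrow> 'a \<Rightarrow>\<^sub>L real) (F'' :: 'a \<Rightarrow> 'a \<Rightarrow>\<^sub>L 'a \<Rightarrow>\<^sub>L real) C.
     open S \<and> z \<in> S \<and>
     (\<forall>x\<in>S. (F has_derivative blinfun_apply (F' x)) (at x)) \<and>
     (\<forall>x\<in>S. (F' has_derivative blinfun_apply (F'' x)) (at x)) \<and>
     continuous_on S F'' \<and>
     (\<forall>x\<in>S. norm (F'' x (x - z) - F' x) \<le> C * (norm (x - z))\<^sup>2))"

text \<open>
  On a ball small enough for \<open>F''\<close> to be bounded, one constant serves all estimates. The linear bound
  on \<open>F'\<close> is read off from the residual.
\<close>

lemma newton_consistentE:
  assumes "newton_consistent F z"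
  obtains r M and F' :: "'a::real_normed_vector \<Rightarrow> 'a \<Rightarrow>\<^sub>L real" and F'' :: "'a \<Rightarrow> 'a \<Rightarrow>\<^sub>L 'a \<Rightarrow>\<^sub>L real"
  where "r > 0" "M \<ge> 0"
    "\<And>x. dist x z < r \<Longrightarrow> (F has_derivative blinfun_apply (F' x)) (at x)"
    "\<And>x. dist x z < r \<Longrightarrow> (F' has_derivative blinfun_apply (F'' x)) (at x)"
    "continuous_on (ball z r) F''"
    "\<And>x. dist x z < r \<Longrightarrow> norm (F'' x (x - z) - F' x) \<le> M * (norm (x - z))\<^sup>2"
    "\<And>x. dist x z < r \<Longrightarrow> norm (F'' x) \<le> M"
    "\<And>x. dist x z < r \<Longrightarrow> norm (F' x) \<le> 2 * M * norm (x - z)"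
proof -
  obtain S F' F'' C where S: "open S" "z \<in> S"
    and F': "\<And>x. x \<in> S \<Longrightarrow> (F has_derivative blinfun_apply (F' x)) (at x)"
    and F'': "\<And>x. x \<in> S \<Longrightarrow> (F' has_derivative blinfun_apply (F'' x)) (at x)"
    and cont: "continuous_on S F''"
    and C: "\<And>x. x \<in> S \<Longrightarrow> norm (F'' x (x - z) - F' x) \<le> C * (norm (x - z))\<^sup>2"
    using assms unfolding newton_consistent_def by metis
  define M where "M = max \<bar>C\<bar> (norm (F'' z) + 1)"
  have "isCont F'' z" using cont S by (simp add: continuous_on_eq_continuous_at)
  then have "\<forall>\<^sub>F x in nhds z. dist (F'' x) (F'' z) < 1"
    by (intro tendstoD) (simp_all add: tendsto_nhds_iff isCont_def)
  then have "\<forall>\<^sub>F x in nhds z. norm (F'' x) \<le> M"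
  proof eventually_elim
    case (elim x)
    then show ?case using norm_triangle_sub[of "F'' x" "F'' z"] by (simp add: M_def dist_norm)
  qed
  moreover have "\<forall>\<^sub>F x in nhds z. x \<in> S" using S by (simp add: eventually_nhds_in_open)
  moreover have "\<forall>\<^sub>F x in nhds z. dist x z < 1"
    by (intro tendstoD filterlim_ident) simp
  ultimately have "\<forall>\<^sub>F x in nhds z. norm (F'' x) \<le> M \<and> x \<in> S \<and> dist x z < 1"
    by eventually_elim simp
  then obtain r where r: "r > 0" "\<And>x. dist x z < r \<Longrightarrow> norm (F'' x) \<le> M \<and> x \<in> S \<and> dist x z < 1"
    unfolding eventually_nhds_metric by blast
  have C': "norm (F'' x (x - z) - F' x) \<le> M * (norm (x - z))\<^sup>2" if "dist x z < r" for x
  proof -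
    have "C \<le> M" unfolding M_def by auto
    then show ?thesis
      using C[of x] r(2)[OF that] by (meson mult_right_mono order_trans zero_le_power2)
  qed
  show ?thesis
  proof
    show "0 < r" by (rule r(1))
    show "0 \<le> M" unfolding M_def by auto
    show "(F has_derivative blinfun_apply (F' x)) (at x)" if "dist x z < r" for x
      using F' r(2)[OF that] by blast
    show "(F' has_derivative blinfun_apply (F'' x)) (at x)" if "dist x z < r" for x
      using F'' r(2)[OF that] by blast
    show "continuous_on (ball z r) F''"
      using cont by (rule continuous_on_subset) (use r(2) in \<open>auto simp: dist_commute\<close>)
    show "norm (F'' x (x - z) - F' x) \<le> M * (norm (x - z))\<^sup>2" if "dist x z < r" for x
      by (rule C'[OF that])
    show "norm (F'' x) \<le> M" if "dist x z < r" for x using r(2)[OF that] by blast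
    show "norm (F' x) \<le> 2 * M * norm (x - z)" if "dist x z < r" for x
    proof -
      have "norm (F' x) \<le> norm (F'' x (x - z)) + norm (F'' x (x - z) - F' x)"
        by (metis norm_triangle_sub norm_minus_commute)
      also have "\<dots> \<le> M * norm (x - z) + M * (norm (x - z))\<^sup>2"
      proof (rule add_mono)
        show "norm (F'' x (x - z)) \<le> M * norm (x - z)"
          using norm_blinfun[of "F'' x" "x - z"] r(2)[OF that] by (meson mult_right_mono norm_ge_zero order_trans)
      qed (rule C'[OF that])
      also have "M * (norm (x - z))\<^sup>2 \<le> M * norm (x - z)"
      proof (rule mult_left_mono)
        show "(norm (x - z))\<^sup>2 \<le> norm (x - z)"
          using r(2)[OF that] by (simp add: power2_eq_square dist_norm mult_left_le)
        show "0 \<le> M" unfolding M_def by auto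
      qed
      finally show ?thesis by simp
    qed
  qed
qed

text \<open>
  Along the ray \<open>t *\<^sub>R x\<close> the derivative of \<open>F'(t x) - t F''(0) x\<close> is \<open>(F''(t x) - F''(0)) x\<close>, which is
  the hypothesis at \<open>t x\<close> divided by \<open>t\<close>. Hence \<open>F'(x)\<close> and, by the hypothesis at \<open>x\<close>, also \<open>F''(x) x\<close>
  differ from \<open>F''(0) x\<close> by at most \<open>\<eta> \<parallel>x\<parallel>\<^sup>2\<close>.
\<close>

lemma radial_hessian_bound_imp_newton_consistent:
  fixes F' :: "'a::real_normed_vector \<Rightarrow> 'a \<Rightarrow>\<^sub>L real"
  assumes S: "open S" "0 \<in> S"
    and F': "\<And>x. x \<in> S \<Longrightarrow> (F has_derivative blinfun_apply (F' x)) (at x)"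
    and F'': "\<And>x. x \<in> S \<Longrightarrow> (F' has_derivative blinfun_apply (F'' x)) (at x)"
    and cont: "continuous_on S F''"
    and crit: "F' 0 = 0"
    and \<eta>: "\<And>x. x \<in> S \<Longrightarrow> norm (F'' x x - F'' 0 x) \<le> \<eta> * (norm x)\<^sup>2"
    and "\<eta> \<ge> 0"
  shows "newton_consistent F 0"
proof -
  obtain r where r: "r > 0" "ball 0 r \<subseteq> S"
    using S open_contains_ball by blast
  have "norm (F'' x x - F' x) \<le> (2 * \<eta>) * (norm x)\<^sup>2" if x: "x \<in> ball 0 r" for x
  proof -
    let ?G = "\<lambda>t. F' (t *\<^sub>R x) - t *\<^sub>R F'' 0 x"
    have "norm (?G 1 - ?G 0) \<le> (\<eta> * (norm x)\<^sup>2) * norm (1 - 0 :: real)"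
    proof (rule differentiable_bound)
      fix t :: real assume t: "t \<in> {0..1}"
      let ?y = "t *\<^sub>R x"
      have "norm ?y \<le> norm x" using t by (simp add: mult_left_le_one_le)
      then have yS: "?y \<in> S" using x r by auto
      let ?G' = "\<lambda>dt. dt *\<^sub>R (F'' ?y x - F'' 0 x)"
      have "((\<lambda>t. F' (t *\<^sub>R x)) has_derivative (\<lambda>dt. F'' ?y (dt *\<^sub>R x))) (at t)"
        by (rule has_derivative_compose[where g = F' and f = "\<lambda>t. t *\<^sub>R x", OF _ F''[OF yS]]) (auto intro!: derivative_eq_intros)
      then have "(?G has_derivative ?G') (at t)"
        by (auto intro!: derivative_eq_intros simp: blinfun.scaleR_right algebra_simps)
      then show "(?G has_derivative ?G') (at t within {0..1})" by (rule has_derivative_at_withinI)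
      have "norm (F'' ?y x - F'' 0 x) \<le> \<eta> * (norm x)\<^sup>2"
      proof (cases "t = 0")
        case False
        have "t * norm (F'' ?y x - F'' 0 x) = norm (F'' ?y ?y - F'' 0 ?y)"
          using t by (simp add: blinfun.scaleR_right flip: scaleR_diff_right)
        also have "\<dots> \<le> \<eta> * (norm ?y)\<^sup>2" by (rule \<eta>[OF yS])
        also have "\<dots> = t * (t * (\<eta> * (norm x)\<^sup>2))"
          by (simp add: power2_eq_square)
        finally have "norm (F'' ?y x - F'' 0 x) \<le> t * (\<eta> * (norm x)\<^sup>2)"
          using False t by simp
        also have "\<dots> \<le> \<eta> * (norm x)\<^sup>2"
          using t \<open>\<eta> \<ge> 0\<close> by (intro mult_left_le_one_le) auto
        finally show ?thesis .
      qed (use \<open>\<eta> \<ge> 0\<close> in simp)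
      then show "onorm ?G' \<le> \<eta> * (norm x)\<^sup>2"
        by (intro onorm_le) (simp add: mult.commute mult_left_mono)
    qed auto
    then have 1: "norm (F' x - F'' 0 x) \<le> \<eta> * (norm x)\<^sup>2" by (simp add: crit)
    have "F'' x x - F' x = (F'' x x - F'' 0 x) - (F' x - F'' 0 x)" by simp
    also have "norm \<dots> \<le> \<eta> * (norm x)\<^sup>2 + \<eta> * (norm x)\<^sup>2"
      using norm_triangle_ineq4[of "F'' x x - F'' 0 x" "F' x - F'' 0 x"] \<eta>[OF subsetD[OF r(2) x]] 1
      by linarith
    finally show ?thesis by simp
  qed
  then show ?thesis
    unfolding newton_consistent_def
    using r F' F'' continuous_on_subset[OF cont r(2)]
    by (intro exI[of _ "ball 0 r"] exI[of _ F'] exI[of _ F''] exI[of _ "2 * \<eta>"]) auto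
qed

text \<open>
  With \<open>u = x - z\<close>, the residual of \<open>F \<circ> \<tau>\<close> is
  \<open>(F''(\<tau> x)(\<tau>'(x) u) - F'(\<tau> x)) \<circ> \<tau>'(x) + F'(\<tau> x) \<circ> \<tau>''(x) u\<close>. By Taylor's formula \<open>\<tau>'(x) u\<close> is
  \<open>\<tau> x - \<tau> z\<close> up to \<open>O(\<parallel>u\<parallel>\<^sup>2)\<close>, which reduces the first term to the residual of \<open>F\<close> at \<open>\<tau> x\<close>; the
  second is a product of two factors of order \<open>\<parallel>u\<parallel>\<close>.
\<close>

lemma newton_consistent_compose:
  fixes \<tau> :: "'a::euclidean_space \<Rightarrow> 'b::euclidean_space"
  assumes "newton_consistent F (\<tau> z)" "open S" "z \<in> S" "C2_on S \<tau>"
  shows "newton_consistent (F \<circ> \<tau>) z"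
proof -
  obtain r M F' F'' where r: "r > 0" "M \<ge> 0"
    and F': "\<And>x. dist x (\<tau> z) < r \<Longrightarrow> (F has_derivative blinfun_apply (F' x)) (at x)"
    and F'': "\<And>x. dist x (\<tau> z) < r \<Longrightarrow> (F' has_derivative blinfun_apply (F'' x)) (at x)"
    and cF'': "continuous_on (ball (\<tau> z) r) F''"
    and res: "\<And>x. dist x (\<tau> z) < r \<Longrightarrow> norm (F'' x (x - \<tau> z) - F' x) \<le> M * (norm (x - \<tau> z))\<^sup>2"
    and bF'': "\<And>x. dist x (\<tau> z) < r \<Longrightarrow> norm (F'' x) \<le> M"
    and bF': "\<And>x. dist x (\<tau> z) < r \<Longrightarrow> norm (F' x) \<le> 2 * M * norm (x - \<tau> z)"
    using newton_consistentE[OF assms(1)] by metis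
  obtain \<tau>' \<tau>'' where \<tau>': "\<And>x. x \<in> S \<Longrightarrow> (\<tau> has_derivative blinfun_apply (\<tau>' x)) (at x)"
    and \<tau>'': "\<And>x. x \<in> S \<Longrightarrow> (\<tau>' has_derivative blinfun_apply (\<tau>'' x)) (at x)"
    and c\<tau>'': "continuous_on S \<tau>''"
    using assms(4) unfolding C2_on_def by metis
  have c\<tau>: "continuous_on S \<tau>" and c\<tau>': "continuous_on S \<tau>'"
    by (auto intro!: continuous_at_imp_continuous_on has_derivative_continuous[OF \<tau>'] has_derivative_continuous[OF \<tau>''])
  define N where "N = max (norm (\<tau>' z) + 1) (norm (\<tau>'' z) + 1)"
  have N: "N \<ge> 0" unfolding N_def by (simp add: max_def)
  have lims: "(\<tau> \<longlongrightarrow> \<tau> z) (nhds z)" "(\<tau>' \<longlongrightarrow> \<tau>' z) (nhds z)" "(\<tau>'' \<longlongrightarrow> \<tau>'' z) (nhds z)"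
    using c\<tau> c\<tau>' c\<tau>'' assms(2,3)
    by (auto simp: continuous_on_eq_continuous_at tendsto_nhds_iff isCont_def)
  have "\<forall>\<^sub>F x in nhds z. dist (\<tau> x) (\<tau> z) < r" "\<forall>\<^sub>F x in nhds z. dist (\<tau>' x) (\<tau>' z) < 1"
    "\<forall>\<^sub>F x in nhds z. dist (\<tau>'' x) (\<tau>'' z) < 1" "\<forall>\<^sub>F x in nhds z. x \<in> S"
    using lims r assms(2,3) by (auto intro!: tendstoD simp: eventually_nhds_in_open)
  then have "\<forall>\<^sub>F x in nhds z. dist (\<tau> x) (\<tau> z) < r \<and> norm (\<tau>' x) \<le> N \<and> norm (\<tau>'' x) \<le> N \<and> x \<in> S"
  proof eventually_elim
    case (elim x)
    then show ?case
      using norm_triangle_sub[of "\<tau>' x" "\<tau>' z"] norm_triangle_sub[of "\<tau>'' x" "\<tau>'' z"]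
      by (auto simp: N_def dist_norm)
  qed
  then obtain d where d: "d > 0"
    "\<And>x. dist x z < d \<Longrightarrow> dist (\<tau> x) (\<tau> z) < r \<and> norm (\<tau>' x) \<le> N \<and> norm (\<tau>'' x) \<le> N \<and> x \<in> S"
    unfolding eventually_nhds_metric by blast
  define G' where "G' x = F' (\<tau> x) o\<^sub>L \<tau>' x" for x
  define D where "D x v = (F'' (\<tau> x) (\<tau>' x v) o\<^sub>L \<tau>' x) + (F' (\<tau> x) o\<^sub>L \<tau>'' x v)" for x v
  define G'' where "G'' x = Blinfun (D x)" for x
  have chain: "((F \<circ> \<tau>) has_derivative blinfun_apply (G' x)) (at x)"
      "(G' has_derivative D x) (at x)" if x: "dist x z < d" for x
  proof -
    have e1: "\<forall>\<^sub>F y in nhds x. (\<tau> has_derivative blinfun_apply (\<tau>' y)) (at y)"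
      using eventually_nhds_in_open[OF assms(2), of x] d(2)[OF x] by (auto elim!: eventually_mono intro: \<tau>')
    have "\<forall>\<^sub>F y in nhds (\<tau> x). y \<in> ball (\<tau> z) r"
      by (rule eventually_nhds_in_open) (use d(2)[OF x] in \<open>auto simp: dist_commute\<close>)
    then have e2: "\<forall>\<^sub>F y in nhds (\<tau> x). (F has_derivative blinfun_apply (F' y)) (at y)"
      by eventually_elim (auto intro: F' simp: dist_commute)
    note c = second_order_chain_rule[OF e1 \<tau>'' e2 F'']
    show "((F \<circ> \<tau>) has_derivative blinfun_apply (G' x)) (at x)"
      unfolding G'_def by (rule eventually_nhds_x_imp_x[OF c(1)]) (use d(2)[OF x] in auto)
    show "(G' has_derivative D x) (at x)"
      unfolding G'_def[abs_def] D_def[abs_def] by (rule c(2)) (use d(2)[OF x] in auto)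
  qed
  have G'': "blinfun_apply (G'' x) = D x" if "dist x z < d" for x
    unfolding G''_def using has_derivative_bounded_linear[OF chain(2)[OF that]]
    by (rule bounded_linear_Blinfun_apply)
  have sub: "ball z d \<subseteq> S" "\<tau> ` ball z d \<subseteq> ball (\<tau> z) r"
    using d(2) by (auto simp: dist_commute)
  have cF': "continuous_on (ball (\<tau> z) r) F'"
    by (auto intro!: continuous_at_imp_continuous_on has_derivative_continuous[OF F''] simp: dist_commute)
  have cont: "continuous_on (ball z d) G''"
  proof -
    have cs: "continuous_on (ball z d) \<tau>" "continuous_on (ball z d) \<tau>'" "continuous_on (ball z d) \<tau>''"
      using c\<tau> c\<tau>' c\<tau>'' sub(1) continuous_on_subset by blast+
    note cc = continuous_on_compose2[OF cF' cs(1) sub(2)] continuous_on_compose2[OF cF'' cs(1) sub(2)]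
    have "continuous_on (ball z d) (\<lambda>x. D x i)" for i
      unfolding D_def
      by (intro continuous_intros bounded_bilinear.continuous_on[OF bounded_bilinear_blinfun_compose] cs cc)
    then have "continuous_on (ball z d) (\<lambda>x. G'' x i)" for i
      by (rule continuous_on_eq) (use G'' in \<open>auto simp: dist_commute\<close>)
    then show ?thesis
      unfolding continuous_on_eq_continuous_within by (blast intro: continuous_blinfun_componentwiseI1)
  qed
  have bound: "norm (G'' x (x - z) - G' x) \<le> (M * (2 * N + N\<^sup>2) * N + 2 * M * N\<^sup>2) * (norm (x - z))\<^sup>2"
    (is "_ \<le> ?C * _")
    if x: "x \<in> ball z d" for x
  proof -
    let ?u = "x - z"
    have xd: "dist x z < d" using x by (simp add: dist_commute)
    note dx = d(2)[OF xd]
    have seg: "dist (x + t *\<^sub>R (z - x)) z \<le> dist x z" if "t \<in> {0..1}" for t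
    proof -
      have "x + t *\<^sub>R (z - x) - z = (1 - t) *\<^sub>R (x - z)" by (simp add: algebra_simps)
      then show ?thesis using that by (simp add: dist_norm mult_left_le_one_le)
    qed
    have lip: "norm (\<tau> x - \<tau> z) \<le> N * norm ?u"
    proof (rule differentiable_bound[of "ball z d" \<tau> "\<lambda>y. blinfun_apply (\<tau>' y)"])
      fix y assume "y \<in> ball z d"
      then have "dist y z < d" by (simp add: dist_commute)
      note dy = d(2)[OF this]
      show "(\<tau> has_derivative blinfun_apply (\<tau>' y)) (at y within ball z d)"
        using \<tau>' dy has_derivative_at_withinI by blast
      show "onorm (\<tau>' y) \<le> N" using dy by (simp add: norm_blinfun.rep_eq)
    qed (use x d in auto)
    have lip': "norm (\<tau>' y - \<tau>' x) \<le> N * norm (y - x)" if "y \<in> ball z d" for y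
    proof (rule differentiable_bound[of "ball z d" \<tau>' "\<lambda>y. blinfun_apply (\<tau>'' y)"])
      fix y assume "y \<in> ball z d"
      then have "dist y z < d" by (simp add: dist_commute)
      note dy = d(2)[OF this]
      show "(\<tau>' has_derivative blinfun_apply (\<tau>'' y)) (at y within ball z d)"
        using \<tau>'' dy has_derivative_at_withinI by blast
      show "onorm (\<tau>'' y) \<le> N" using dy by (simp add: norm_blinfun.rep_eq)
    qed (use x that in auto)
    \<comment> \<open>The factor \<open>2\<close>: points of the ball around \<open>z\<close> of radius \<open>norm ?u\<close> have
      distance at most \<open>2 * norm ?u\<close> from \<open>x\<close>.\<close>
    have "norm (\<tau> z - \<tau> x - \<tau>' x (z - x)) \<le> norm (z - x) * (N * (2 * norm ?u))"
    proof (rule differentiable_bound_linearization[where S = "cball z (dist x z)" and f' = "\<lambda>y. blinfun_apply (\<tau>' y)"])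
      fix y assume y: "y \<in> cball z (dist x z)"
      then have yd: "dist y z < d" using xd by (simp add: dist_commute)
      note dy = d(2)[OF this]
      show "(\<tau> has_derivative blinfun_apply (\<tau>' y)) (at y within cball z (dist x z))"
        using \<tau>' dy has_derivative_at_withinI by blast
      have "norm (\<tau>' y - \<tau>' x) \<le> N * norm (y - x)"
        by (rule lip') (use yd in \<open>simp add: dist_commute\<close>)
      also have "\<dots> \<le> N * (2 * norm ?u)"
        using y dist_triangle[of y x z] by (intro mult_left_mono N) (simp add: dist_norm[symmetric] dist_commute)
      finally show "onorm (blinfun_apply (\<tau>' y) - blinfun_apply (\<tau>' x)) \<le> N * (2 * norm ?u)"
        by (simp add: norm_blinfun.rep_eq minus_blinfun.rep_eq fun_diff_def)
    qed (use seg in \<open>auto simp: dist_commute\<close>)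
    also have "\<dots> = 2 * N * (norm ?u)\<^sup>2"
      by (simp add: norm_minus_commute power2_eq_square)
    also have "\<tau> z - \<tau> x - \<tau>' x (z - x) = \<tau>' x ?u - (\<tau> x - \<tau> z)"
      by (simp add: blinfun.diff_right)
    finally have e: "norm (\<tau>' x ?u - (\<tau> x - \<tau> z)) \<le> 2 * N * (norm ?u)\<^sup>2" .
    let ?w = "\<tau> x - \<tau> z"
    have w2: "(norm ?w)\<^sup>2 \<le> N\<^sup>2 * (norm ?u)\<^sup>2"
      using power_mono[OF lip, of 2] by (simp add: power_mult_distrib)
    have "norm (F'' (\<tau> x) (\<tau>' x ?u - ?w)) \<le> M * (2 * N * (norm ?u)\<^sup>2)"
      using bF''[of "\<tau> x"] dx e r(2) by (intro order_trans[OF norm_blinfun] mult_mono) auto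
    moreover have "norm (F'' (\<tau> x) ?w - F' (\<tau> x)) \<le> M * (N\<^sup>2 * (norm ?u)\<^sup>2)"
      using res[of "\<tau> x"] dx w2 r(2) by (meson mult_left_mono order_trans)
    moreover have "F'' (\<tau> x) (\<tau>' x ?u) - F' (\<tau> x) =
        F'' (\<tau> x) (\<tau>' x ?u - ?w) + (F'' (\<tau> x) ?w - F' (\<tau> x))"
      by (simp add: blinfun.diff_right)
    ultimately have "norm (F'' (\<tau> x) (\<tau>' x ?u) - F' (\<tau> x)) \<le>
        M * (2 * N * (norm ?u)\<^sup>2) + M * (N\<^sup>2 * (norm ?u)\<^sup>2)" (is "_ \<le> ?a")
      using norm_triangle_mono by metis
    then have 1: "norm ((F'' (\<tau> x) (\<tau>' x ?u) - F' (\<tau> x)) o\<^sub>L \<tau>' x) \<le> ?a * N"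
      using dx N r(2) by (intro order_trans[OF norm_blinfun_compose] mult_mono) auto
    have "norm (\<tau>'' x ?u) \<le> N * norm ?u"
      using dx by (intro order_trans[OF norm_blinfun] mult_right_mono) auto
    moreover have "norm (F' (\<tau> x)) \<le> 2 * M * (N * norm ?u)"
      using bF'[of "\<tau> x"] dx lip r(2) by (meson mult_left_mono order_trans mult_nonneg_nonneg zero_le_numeral)
    ultimately have 2: "norm (F' (\<tau> x) o\<^sub>L \<tau>'' x ?u) \<le> 2 * M * (N * norm ?u) * (N * norm ?u)"
      using N r(2) by (intro order_trans[OF norm_blinfun_compose] mult_mono) auto
    have "G'' x ?u - G' x =
        ((F'' (\<tau> x) (\<tau>' x ?u) - F' (\<tau> x)) o\<^sub>L \<tau>' x) + (F' (\<tau> x) o\<^sub>L \<tau>'' x ?u)"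
      by (intro blinfun_eqI) (simp add: G''[OF xd] D_def G'_def blinfun.bilinear_simps)
    also have "norm \<dots> \<le> ?a * N + 2 * M * (N * norm ?u) * (N * norm ?u)"
      by (rule norm_triangle_mono[OF 1 2])
    also have "\<dots> = ?C * (norm ?u)\<^sup>2"
      by (simp add: algebra_simps power2_eq_square)
    finally show ?thesis .
  qed
  show ?thesis
    unfolding newton_consistent_def
    using d(1) chain cont bound G''
    by (intro exI[of _ "ball z d"] exI[of _ G'] exI[of _ G''] exI) (auto simp: dist_commute)
qed

section \<open>A single Newton step\<close>

text \<open>
  This translates between derivatives as linear maps, for which the chain rule is convenient, and
  the gradients and Hessian matrices by which the Newton iteration function is defined.
\<close>

lemma derivatives_as_gradient_hessian:
  fixes g :: "real^'n \<Rightarrow> real"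
  assumes g': "\<forall>\<^sub>F y in nhds x. (g has_derivative blinfun_apply (g' y)) (at y)"
    and B: "(g' has_derivative blinfun_apply B) (at x)"
  shows "g' x w = inner w (gradient g x)" and "B v w = inner w (hessian g x *v v)"
proof -
  have sd: "has_second_derivative g B x"
    using g' B unfolding has_second_derivative_def by blast
  note gr = has_second_derivative_hessian[OF sd]
  have ev: "\<forall>\<^sub>F y in nhds x. g' y w = inner w (gradient g y)" for w
    using g' gr(1)
  proof eventually_elim
    case (elim y)
    from has_derivative_unique[OF elim(1) elim(2)[unfolded gderiv_def]] show ?case by metis
  qed
  show "g' x w = inner w (gradient g x)"
    by (rule eventually_nhds_x_imp_x[OF ev])
  have "((\<lambda>y. g' y w) has_derivative (\<lambda>v. B v w)) (at x)"
    using bounded_linear.has_derivative[OF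
        bounded_bilinear.bounded_linear_left[OF bounded_bilinear_blinfun_apply] B] .
  from eventually_has_derivative_transform[OF this ev]
  have "((\<lambda>y. inner w (gradient g y)) has_derivative (\<lambda>v. B v w)) (at x)" .
  moreover have "((\<lambda>y. inner w (gradient g y)) has_derivative (\<lambda>v. inner w (hessian g x *v v))) (at x)"
    using gr(2) by (rule has_derivative_inner_right)
  ultimately show "B v w = inner w (hessian g x *v v)"
    using has_derivative_unique by metis
qed

text \<open>
  A lower bound expresses non-degeneracy in a form that survives small perturbations of the second
  derivative.
\<close>

lemma invertible_hessian_imp_coercive:
  fixes g :: "real^'n \<Rightarrow> real"
  assumes g': "\<forall>\<^sub>F y in nhds x. (g has_derivative blinfun_apply (g' y)) (at y)"
    and B: "(g' has_derivative blinfun_apply B) (at x)"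
    and "invertible (hessian g x)"
  shows "\<exists>m>0. \<forall>v. m * norm v \<le> norm (B v)"
proof -
  let ?H = "hessian g x"
  obtain m where m: "m > 0" "\<And>v. m * norm v \<le> norm (?H *v v)"
    using linear_inj_bounded_below_pos[of "(*v) ?H"] inj_matrix_vector_mult[OF assms(3)]
    by (auto simp: mult.commute)
  have "norm (?H *v v) \<le> norm (B v)" for v
  proof (cases "?H *v v = 0")
    case False
    have "norm (?H *v v) * norm (?H *v v) = B v (?H *v v)"
      by (simp add: derivatives_as_gradient_hessian(2)[OF g' B] power2_norm_eq_inner flip: power2_eq_square)
    also have "\<dots> \<le> norm (B v) * norm (?H *v v)"
      using norm_blinfun[of "B v" "?H *v v"] by simp
    finally show ?thesis using False by simp
  qed simp
  then show ?thesis using m order_trans by metis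
qed

lemma coercive_imp_newton_defined:
  fixes g :: "real^'n \<Rightarrow> real"
  assumes g': "\<forall>\<^sub>F y in nhds x. (g has_derivative blinfun_apply (g' y)) (at y)"
    and B: "(g' has_derivative blinfun_apply B) (at x)"
    and m: "m > 0" "\<And>v. m * norm v \<le> norm (B v)"
  shows "newton_defined g x" and "B (newton g x - x) = - g' x"
proof -
  let ?H = "hessian g x"
  note gh = derivatives_as_gradient_hessian[OF g' B]
  have "v = 0" if "?H *v v = 0" for v
  proof -
    have "B v = 0" by (rule blinfun_eqI) (simp add: gh(2) that)
    then show ?thesis using m(2)[of v] m(1) by (simp add: mult_le_0_iff)
  qed
  then have inv: "invertible ?H"
    using matrix_left_invertible_ker[of ?H] invertible_left_inverse by blast
  then show "newton_defined g x"
    unfolding newton_defined_def has_second_derivative_def using g' B by blast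
  show "B (newton g x - x) = - g' x"
    by (rule blinfun_eqI)
      (simp add: gh newton_def blinfun.bilinear_simps matrix_vector_mul_assoc matrix_inv_inverse(1)[OF inv]
        vec.neg inner_minus_right)
qed

text \<open>
  Here \<open>h\<close> stands for a map \<open>\<phi>\<^sub>p\<close> in coordinates and \<open>g\<close> for \<open>f \<circ> \<phi>\<^sub>p\<close>, which agrees with \<open>F \<circ> h\<close>
  only where \<open>\<phi>\<^sub>p\<close> stays in the domain of the chart. The second derivative \<open>G\<close> of \<open>g\<close> at \<open>0\<close> is
  \<open>F''(x) + F'(x) \<circ> B\<close>, close to \<open>F''(z)\<close> and hence uniformly coercive. Since
  \<open>G y = - F'(x)\<close> for the Newton step \<open>y\<close>, the vector \<open>y + (x - z)\<close> is mapped by \<open>G\<close> to the residual of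
  \<open>F\<close> plus \<open>F'(x) \<circ> B (x - z)\<close>, both of second order.
\<close>

lemma newton_step_quadratic:
  fixes F :: "real^'n \<Rightarrow> real"
  assumes "newton_consistent F z" and "invertible (hessian F z)"
  shows "\<exists>r>0. \<exists>K\<ge>0. \<forall>x h B g. dist x z < r \<longrightarrow> h 0 = x \<longrightarrow> (h has_derivative id) (at 0) \<longrightarrow>
    has_second_derivative h B 0 \<longrightarrow> norm B \<le> \<alpha> \<longrightarrow> (\<forall>\<^sub>F y in nhds 0. F (h y) = g y) \<longrightarrow>
    newton_defined g 0 \<and> norm (newton g 0 + (x - z)) \<le> K * (norm (x - z))\<^sup>2"
proof -
  obtain r M F' F'' where r: "r > 0" "M \<ge> 0"
    and F': "\<And>x. dist x z < r \<Longrightarrow> (F has_derivative blinfun_apply (F' x)) (at x)"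
    and F'': "\<And>x. dist x z < r \<Longrightarrow> (F' has_derivative blinfun_apply (F'' x)) (at x)"
    and cF'': "continuous_on (ball z r) F''"
    and res: "\<And>x. dist x z < r \<Longrightarrow> norm (F'' x (x - z) - F' x) \<le> M * (norm (x - z))\<^sup>2"
    and bF': "\<And>x. dist x z < r \<Longrightarrow> norm (F' x) \<le> 2 * M * norm (x - z)"
    using newton_consistentE[OF assms(1)] by metis
  have evF': "\<forall>\<^sub>F y in nhds x. (F has_derivative blinfun_apply (F' y)) (at y)" if "dist x z < r" for x
  proof -
    have "\<forall>\<^sub>F y in nhds x. y \<in> ball z r"
      by (rule eventually_nhds_in_open) (use that in \<open>auto simp: dist_commute\<close>)
    then show ?thesis by eventually_elim (auto intro: F' simp: dist_commute)
  qed
  obtain m where m: "m > 0" "\<And>v. m * norm v \<le> norm (F'' z v)"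
    using invertible_hessian_imp_coercive[OF evF' F'' assms(2)] r(1) by auto
  define a where "a = \<bar>\<alpha>\<bar>"
  have "isCont F'' z" using cF'' r(1) by (simp add: continuous_on_eq_continuous_at)
  then have ev1: "\<forall>\<^sub>F x in nhds z. dist (F'' x) (F'' z) < m / 4"
    using m(1) by (intro tendstoD) (simp_all add: tendsto_nhds_iff isCont_def)
  \<comment> \<open>Each of the two perturbations of \<open>F'' z\<close> may use up a quarter of the coercivity constant.\<close>
  have "((\<lambda>x. 2 * M * norm (x - z) * a) \<longlongrightarrow> 2 * M * norm (z - z) * a) (nhds z)"
    by (intro tendsto_intros filterlim_ident)
  then have "\<forall>\<^sub>F x in nhds z. 2 * M * norm (x - z) * a < m / 4"
    using m(1) by (intro order_tendstoD) auto
  with ev1 have "\<forall>\<^sub>F x in nhds z. dist (F'' x) (F'' z) < m / 4 \<and> 2 * M * norm (x - z) * a < m / 4"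
    by eventually_elim simp
  then obtain d where d: "d > 0"
    "\<And>x. dist x z < d \<Longrightarrow> dist (F'' x) (F'' z) < m / 4 \<and> 2 * M * norm (x - z) * a < m / 4"
    unfolding eventually_nhds_metric by blast
  define K where "K = (M + 2 * M * a) * (2 / m)"
  have "min r d > 0" using r d by simp
  moreover have "K \<ge> 0" using r m by (simp add: K_def a_def)
  moreover have "newton_defined g 0 \<and> norm (newton g 0 + (x - z)) \<le> K * (norm (x - z))\<^sup>2"
    if x: "dist x z < min r d" and h0: "h 0 = x" and h1: "(h has_derivative id) (at 0)"
      and h2: "has_second_derivative h B 0" and B\<alpha>: "norm B \<le> \<alpha>"
      and g: "\<forall>\<^sub>F y in nhds 0. F (h y) = g y" for x h B and g :: "real^'n \<Rightarrow> real"
  proof -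
    have xr: "dist x z < r" and xd: "dist x z < d" using x by auto
    obtain h' where h': "\<forall>\<^sub>F y in nhds 0. (h has_derivative blinfun_apply (h' y)) (at y)"
      and B: "(h' has_derivative blinfun_apply B) (at 0)"
      using h2 unfolding has_second_derivative_def by blast
    have id: "h' 0 v = v" for v
      using has_derivative_unique[OF eventually_nhds_x_imp_x[OF h'] h1] by simp
    note chain = second_order_chain_rule[OF h' B, of F F' "F'' x", unfolded h0, OF evF'[OF xr] F''[OF xr]]
    let ?G = "\<lambda>y. F' (h y) o\<^sub>L h' y"
    from g have "\<forall>\<^sub>F y in nhds 0. \<forall>\<^sub>F y' in nhds y. F (h y') = g y'"
      by (simp add: eventually_eventually)
    then have g': "\<forall>\<^sub>F y in nhds 0. (g has_derivative blinfun_apply (?G y)) (at y)"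
      using chain(1)
      by eventually_elim (auto intro: eventually_has_derivative_transform simp: o_def)
    define G2 where "G2 = Blinfun (\<lambda>v. (F'' x (h' 0 v) o\<^sub>L h' 0) + (F' x o\<^sub>L B v))"
    have G2: "blinfun_apply G2 = (\<lambda>v. (F'' x (h' 0 v) o\<^sub>L h' 0) + (F' x o\<^sub>L B v))"
      unfolding G2_def using has_derivative_bounded_linear[OF chain(2)] by (rule bounded_linear_Blinfun_apply)
    have dG: "(?G has_derivative blinfun_apply G2) (at 0)" unfolding G2 by (rule chain(2))
    have G2v: "G2 v = F'' x v + (F' x o\<^sub>L B v)" for v
      by (rule blinfun_eqI) (simp add: G2 id blinfun.bilinear_simps)
    have G0: "?G 0 = F' x"
      by (rule blinfun_eqI) (simp add: id h0)
    have aB: "norm B \<le> a" using B\<alpha> by (simp add: a_def)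
    have FB: "norm (F' x o\<^sub>L B v) \<le> 2 * M * norm (x - z) * a * norm v" for v
    proof -
      have "norm (B v) \<le> a * norm v"
        using aB by (intro order_trans[OF norm_blinfun] mult_right_mono) auto
      then have "norm (F' x) * norm (B v) \<le> (2 * M * norm (x - z)) * (a * norm v)"
        using bF'[OF xr] r by (intro mult_mono) (auto simp: a_def)
      then show ?thesis using norm_blinfun_compose[of "F' x" "B v"] by (simp add: mult.assoc)
    qed
    have coercive: "m / 2 * norm v \<le> norm (G2 v)" for v
    proof -
      have "norm ((F'' x - F'' z) v) \<le> m / 4 * norm v"
        using d(2)[OF xd] by (intro order_trans[OF norm_blinfun] mult_right_mono) (auto simp: dist_norm)
      moreover have "norm (F' x o\<^sub>L B v) \<le> m / 4 * norm v"
        using d(2)[OF xd] by (intro order_trans[OF FB] mult_right_mono) auto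
      moreover have "norm (F'' z v) \<le> norm (G2 v) + norm ((F'' x - F'' z) v + (F' x o\<^sub>L B v))"
        using norm_triangle_ineq4[of "G2 v" "(F'' x - F'' z) v + (F' x o\<^sub>L B v)"]
        by (simp add: G2v blinfun.diff_left)
      moreover note norm_triangle_ineq[of "(F'' x - F'' z) v" "F' x o\<^sub>L B v"] m(2)[of v]
      ultimately show ?thesis by simp
    qed
    have m2: "m / 2 > 0" using m(1) by simp
    note nd = coercive_imp_newton_defined[OF g' dG m2 coercive]
    let ?y = "newton g 0" and ?u = "x - z"
    have "G2 (?y + ?u) = (F'' x ?u - F' x) + (F' x o\<^sub>L B ?u)"
      using nd(2) by (simp add: blinfun.add_right G0[simplified] G2v[of ?u])
    also have "norm \<dots> \<le> M * (norm ?u)\<^sup>2 + 2 * M * norm ?u * a * norm ?u"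
      by (rule norm_triangle_mono[OF res[OF xr] FB])
    finally have "m / 2 * norm (?y + ?u) \<le> (M + 2 * M * a) * (norm ?u)\<^sup>2"
      using coercive[of "?y + ?u"] by (simp add: algebra_simps power2_eq_square)
    then have "norm (?y + ?u) \<le> K * (norm ?u)\<^sup>2"
      using m(1) by (simp add: K_def field_simps)
    with nd(1) show ?thesis by blast
  qed
  ultimately show ?thesis by blast
qed

section \<open>Path-dependent iterations\<close>

text \<open>
  The state carries the past iterates because the next step may depend on them.
\<close>

primrec orbit :: "'m path_iteration \<Rightarrow> 'm \<Rightarrow> nat \<Rightarrow> 'm list \<times> 'm" where
  "orbit E p 0 = ([], p)"
| "orbit E p (Suc k) = (case orbit E p k of (ps, q) \<Rightarrow> (ps @ [q], the (E k ps q)))"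

lemma iterates_orbit:
  assumes "p0 \<in> V"
    and step: "\<And>k ps p. length ps = k \<Longrightarrow> p \<in> V \<Longrightarrow> \<exists>q\<in>V. E k ps p = Some q"
  shows "iterates E p0 (\<lambda>k. snd (orbit E p0 k))" and "snd (orbit E p0 k) \<in> V"
proof -
  let ?p = "\<lambda>k. snd (orbit E p0 k)"
  have past: "fst (orbit E p0 k) = map ?p [0..<k]" for k
    by (induction k) (auto simp: split_beta)
  have suc: "?p (Suc k) = the (E k (map ?p [0..<k]) (?p k))" for k
    by (simp add: split_beta past)
  have in_V: "?p k \<in> V" for k
  proof (induction k)
    case (Suc k)
    from step[OF _ this, of "map ?p [0..<k]" k] show ?case by (auto simp: suc simp del: orbit.simps)
  qed (simp add: assms(1))
  show "?p k \<in> V" by (rule in_V)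
  have "E k (map ?p [0..<k]) (?p k) = Some (?p (Suc k))" for k
    using step[OF _ in_V, of "map ?p [0..<k]" k k] by (auto simp: suc simp del: orbit.simps)
  then show "iterates E p0 ?p" unfolding iterates_def by simp
qed

text \<open>
  On a ball of radius at most \<open>1 / (2 \<kappa>)\<close> a quadratic step halves the distance to \<open>q\<close>, so the ball is
  invariant and the iterates converge geometrically. The preimage of the ball under the chart is the
  required neighbourhood.
\<close>

lemma quadratic_steps_imp_converges_locally_quadratically:
  fixes E :: "'m::topological_space path_iteration" and \<A> :: "('m, 'n::finite) chart set"
  assumes c: "(U, \<phi>) \<in> charts_at \<A> q" and "\<phi> q = 0" and "r > 0"
    and step: "\<And>k ps p. length ps = k \<Longrightarrow> p \<in> U \<Longrightarrow> norm (\<phi> p) < r \<Longrightarrow>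
      \<exists>p'\<in>U. E k ps p = Some p' \<and> norm (\<phi> p') \<le> \<kappa> * (norm (\<phi> p))\<^sup>2"
  shows "converges_locally_quadratically \<A> E q"
proof -
  have ch: "q \<in> U" "open U" "open (\<phi> ` U)"
    and hom: "homeomorphism U (\<phi> ` U) \<phi> (inv_into U \<phi>)"
    using c by (auto simp: charts_at_def C2_charts_def is_chart_def)
  \<comment> \<open>The given \<open>\<kappa>\<close> may be zero or negative.\<close>
  define k0 where "k0 = max \<kappa> 1"
  define d where "d = min r (1 / (2 * k0))"
  have k0: "k0 > 0" "\<kappa> \<le> k0" and d: "d > 0" "d \<le> r" "k0 * d \<le> 1 / 2"
    using \<open>r > 0\<close> by (auto simp: k0_def d_def field_simps min_def)
  define V where "V = U \<inter> \<phi> -` ball 0 d"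
  have "open V"
    unfolding V_def using hom ch
    by (intro continuous_open_preimage) (auto simp: homeomorphism_def)
  have halve: "k0 * (norm (\<phi> p))\<^sup>2 \<le> norm (\<phi> p) / 2" if "p \<in> V" for p
  proof -
    have "norm (\<phi> p) \<le> d" using that by (simp add: V_def)
    then have "k0 * norm (\<phi> p) \<le> k0 * d"
      using k0(1) by (intro mult_left_mono) auto
    then have "k0 * norm (\<phi> p) * norm (\<phi> p) \<le> 1 / 2 * norm (\<phi> p)"
      using d(3) by (intro mult_right_mono) auto
    then show ?thesis by (simp add: power2_eq_square)
  qed
  have step': "\<exists>p'\<in>V. E k ps p = Some p' \<and> norm (\<phi> p') \<le> k0 * (norm (\<phi> p))\<^sup>2"
    if len: "length ps = k" and pV: "p \<in> V" for k ps p
  proof -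
    have p: "p \<in> U" "norm (\<phi> p) < d" using pV by (auto simp: V_def)
    then obtain p' where p': "p' \<in> U" "E k ps p = Some p'" "norm (\<phi> p') \<le> \<kappa> * (norm (\<phi> p))\<^sup>2"
      using step[OF len, of p] d(2) by auto
    have le: "norm (\<phi> p') \<le> k0 * (norm (\<phi> p))\<^sup>2"
      using p'(3) k0(2) by (meson mult_right_mono order_trans zero_le_power2)
    then have "norm (\<phi> p') < d" using halve[OF pV] p(2) norm_ge_zero[of "\<phi> p"] by linarith
    then show ?thesis using p' le by (auto simp: V_def)
  qed
  have "\<exists>p. iterates E p0 p \<and> (\<forall>k. p k \<in> V) \<and> p \<longlonglongrightarrow> q \<and>
      (\<forall>k. norm (\<phi> (p (Suc k)) - \<phi> q) \<le> k0 * (norm (\<phi> (p k) - \<phi> q))\<^sup>2)" if p0: "p0 \<in> V" for p0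
  proof -
    have ex: "\<exists>p'\<in>V. E k ps p = Some p'" if "length ps = k" "p \<in> V" for k ps p
      using step'[OF that] by blast
    define p where "p k = snd (orbit E p0 k)" for k
    have it: "iterates E p0 p" and V: "p k \<in> V" for k
      unfolding p_def[abs_def] using iterates_orbit[OF p0, of E] ex by blast+
    have "E k (map p [0..<k]) (p k) = Some (p (Suc k))" for k
      using it unfolding iterates_def by blast
    then have quad: "norm (\<phi> (p (Suc k))) \<le> k0 * (norm (\<phi> (p k)))\<^sup>2" for k
      using step'[of "map p [0..<k]" k "p k"] V by auto
    have geo: "norm (\<phi> (p k)) \<le> norm (\<phi> p0) * (1 / 2) ^ k" for k
    proof (induction k)
      case 0
      then show ?case using it by (simp add: iterates_def)
    next
      case (Suc k)
      then show ?case using quad[of k] halve[OF V, of k] by simp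
    qed
    have "(\<lambda>k. norm (\<phi> p0) * (1 / 2) ^ k) \<longlonglongrightarrow> 0"
      by (rule tendsto_mult_right_zero[OF LIMSEQ_power_zero]) simp
    then have "(\<lambda>k. \<phi> (p k)) \<longlonglongrightarrow> 0"
      by (rule Lim_null_comparison[rotated]) (simp add: geo)
    then have "(\<lambda>k. \<phi> (p k)) \<longlonglongrightarrow> \<phi> q" by (simp add: \<open>\<phi> q = 0\<close>)
    moreover have "isCont (inv_into U \<phi>) (\<phi> q)"
      using hom ch by (auto simp: homeomorphism_def continuous_on_eq_continuous_at)
    ultimately have "(\<lambda>k. inv_into U \<phi> (\<phi> (p k))) \<longlonglongrightarrow> inv_into U \<phi> (\<phi> q)"
      by (rule isCont_tendsto_compose[rotated])
    moreover have "inv_into U \<phi> (\<phi> x) = x" if "x \<in> U" for x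
      using hom that by (auto simp: homeomorphism_def)
    ultimately have "p \<longlonglongrightarrow> q" using V ch by (simp add: V_def)
    then show ?thesis using it V quad \<open>\<phi> q = 0\<close> by auto
  qed
  moreover have "q \<in> V" using ch d \<open>\<phi> q = 0\<close> by (simp add: V_def)
  ultimately show ?thesis
    unfolding converges_locally_quadratically_def using c \<open>open V\<close>
    by (intro exI[of _ U] exI[of _ \<phi>] exI[of _ V] exI[of _ k0]) (auto simp: V_def)
qed

section \<open>Transfer to the manifold\<close>

lemma newton_consistent_cong:
  assumes F: "newton_consistent F z" and T: "open T" "z \<in> T" and eq: "\<And>x. x \<in> T \<Longrightarrow> F x = G x"
  shows "newton_consistent G z"
proof -
  obtain S F' F'' C where S: "open S" "z \<in> S"
    and F': "\<And>x. x \<in> S \<Longrightarrow> (F has_derivative blinfun_apply (F' x)) (at x)"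
    and F'': "\<And>x. x \<in> S \<Longrightarrow> (F' has_derivative blinfun_apply (F'' x)) (at x)"
    and cont: "continuous_on S F''"
    and C: "\<And>x. x \<in> S \<Longrightarrow> norm (F'' x (x - z) - F' x) \<le> C * (norm (x - z))\<^sup>2"
    using F unfolding newton_consistent_def by metis
  have "(G has_derivative blinfun_apply (F' x)) (at x)" if "x \<in> S \<inter> T" for x
    using has_derivative_transform_within_open[OF F' T(1)] that eq by auto
  then show ?thesis
    unfolding newton_consistent_def
    using S T F'' C continuous_on_subset[OF cont]
    by (intro exI[of _ "S \<inter> T"] exI[of _ F'] exI[of _ F''] exI[of _ C]) auto
qed

lemma newton_consistent_change_chart:
  assumes ch: "is_chart c" "is_chart c'" "p \<in> fst c" "p \<in> fst c'"
    and comp: "C2_on (snd c' ` (fst c' \<inter> fst c)) (transition c' c)"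
    and F: "newton_consistent (f \<circ> chart_inv c) (snd c p)"
  shows "newton_consistent (f \<circ> chart_inv c') (snd c' p)"
proof -
  let ?S = "snd c' ` (fst c' \<inter> fst c)"
  have hom: "homeomorphism (fst c') (snd c' ` fst c') (snd c') (chart_inv c')"
    and o: "open (snd c' ` fst c')" "open (fst c)"
    using ch by (auto simp: is_chart_def)
  have inv: "chart_inv d (snd d x) = x" if "is_chart d" "x \<in> fst d" for d :: "('a, 'b) chart" and x
    using that by (auto simp: is_chart_def homeomorphism_def)
  have "?S = snd c' ` fst c' \<inter> chart_inv c' -` fst c"
    using inv[OF ch(2)] by force
  then have S: "open ?S"
    using hom o by (auto simp: homeomorphism_def intro!: continuous_open_preimage)
  have p: "snd c' p \<in> ?S" using ch by auto
  have "newton_consistent ((f \<circ> chart_inv c) \<circ> transition c' c) (snd c' p)"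
    using newton_consistent_compose[OF _ S p comp, of "f \<circ> chart_inv c"] F ch by (simp add: transition_at)
  then show ?thesis
    by (rule newton_consistent_cong[OF _ S p]) (use ch in \<open>auto simp: transition_def inv\<close>)
qed

text \<open>
  Two charts of the maximal atlas are compatible with every chart of the atlas, so the change of
  charts is made in two steps through a chart of the atlas around \<open>p\<close>.
\<close>

lemma newton_consistent_all_charts:
  fixes \<A> :: "('m::{t2_space, second_countable_topology}, 'n::finite) chart set"
  assumes "C2_manifold \<A>" "c \<in> charts_at \<A> p" "c' \<in> charts_at \<A> p"
    and F: "newton_consistent (f \<circ> chart_inv c) (snd c p)"
  shows "newton_consistent (f \<circ> chart_inv c') (snd c' p)"
proof -
  obtain a where a: "a \<in> \<A>" "p \<in> fst a"
    using assms(1) unfolding C2_manifold_def by blast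
  have ch: "is_chart a" "is_chart c" "is_chart c'" "p \<in> fst c" "p \<in> fst c'"
    and comp: "C2_compatible a c" "C2_compatible a c'"
    using a assms by (auto simp: C2_manifold_def charts_at_def C2_charts_def)
  have "newton_consistent (f \<circ> chart_inv a) (snd a p)"
    using newton_consistent_change_chart[OF ch(2,1,4) a(2) _ F] comp(1) by (simp add: C2_compatible_def)
  then show ?thesis
    using newton_consistent_change_chart[OF ch(1,3) a(2) ch(5)] comp(2) by (simp add: C2_compatible_def)
qed

lemma newton_consistent_at_critical_point:
  fixes \<A> :: "('m::{t2_space, second_countable_topology}, 'n::finite) chart set"
  assumes f: "C2_fun \<A> f" and crit: "critical_point \<A> f p"
    and c: "(U, \<phi>) \<in> charts_at \<A> p" and "\<phi> p = 0" and "\<eta> \<ge> 0"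
    and \<eta>: "\<And>x. x \<in> \<phi> ` U \<Longrightarrow>
           norm ((hessian (f \<circ> inv_into U \<phi>) x - hessian (f \<circ> inv_into U \<phi>) 0) *v x)
             \<le> \<eta> * (norm x)\<^sup>2"
  shows "newton_consistent (f \<circ> inv_into U \<phi>) 0"
proof -
  let ?F = "f \<circ> inv_into U \<phi>" and ?S = "\<phi> ` U"
  have "(U, \<phi>) \<in> C2_charts \<A>" and S: "open ?S" "0 \<in> ?S"
    using c \<open>\<phi> p = 0\<close> by (force simp: charts_at_def C2_charts_def is_chart_def)+
  then have "C2_on ?S ?F" using f unfolding C2_fun_def by force
  then obtain F' F'' where F': "\<And>x. x \<in> ?S \<Longrightarrow> (?F has_derivative blinfun_apply (F' x)) (at x)"
    and F'': "\<And>x. x \<in> ?S \<Longrightarrow> (F' has_derivative blinfun_apply (F'' x)) (at x)"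
    and cont: "continuous_on ?S F''"
    unfolding C2_on_def by metis
  have "(?F has_derivative (\<lambda>_. 0)) (at 0)"
    using crit c \<open>\<phi> p = 0\<close> unfolding critical_point_def by force
  from has_derivative_unique[OF F'[OF S(2)] this] have crit0: "F' 0 = 0"
    by (intro blinfun_eqI) simp
  have hess: "F'' x v w = inner w (hessian ?F x *v v)" if "x \<in> ?S" for x v w
  proof (rule derivatives_as_gradient_hessian(2))
    show "\<forall>\<^sub>F y in nhds x. (?F has_derivative blinfun_apply (F' y)) (at y)"
      using eventually_nhds_in_open[OF S(1) that] by (rule eventually_mono) (rule F')
  qed (rule F''[OF that])
  show ?thesis
  proof (rule radial_hessian_bound_imp_newton_consistent[OF S F' F'' cont crit0 _ \<open>\<eta> \<ge> 0\<close>])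
    fix x assume x: "x \<in> ?S"
    show "norm (F'' x x - F'' 0 x) \<le> \<eta> * (norm x)\<^sup>2"
    proof (rule norm_blinfun_bound)
      fix w
      have "(F'' x x - F'' 0 x) w = inner w ((hessian ?F x - hessian ?F 0) *v x)"
        by (simp add: blinfun.diff_left hess[OF x] hess[OF S(2)] matrix_vector_mult_diff_rdistrib inner_diff_right)
      then have "norm ((F'' x x - F'' 0 x) w) \<le> norm w * norm ((hessian ?F x - hessian ?F 0) *v x)"
        by (simp add: Cauchy_Schwarz_ineq2)
      also have "\<dots> \<le> norm w * (\<eta> * (norm x)\<^sup>2)"
        using \<eta>[OF x] by (intro mult_left_mono) auto
      finally show "norm ((F'' x x - F'' 0 x) w) \<le> \<eta> * (norm x)\<^sup>2 * norm w"
        by (simp add: mult.commute)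
    qed (use \<open>\<eta> \<ge> 0\<close> in simp)
  qed
qed

lemma tangent_vec_zero:
  assumes "C2_manifold \<A>" "c \<in> charts_at \<A> p"
  shows "tangent_vec \<A> c p 0 = zero_tangent" and "zero_tangent \<in> tangent_space \<A> p"
proof -
  have "frechet_derivative (transition c c') (at (snd c p)) 0 = 0"
    if "c \<in> charts_at \<A> p" "c' \<in> charts_at \<A> p" for c c'
    using transition_differentiable[OF assms(1) that] linear_frechet_derivative linear_0 by blast
  then show zero: "zero_tangent \<in> tangent_space \<A> p"
    unfolding tangent_space_def zero_tangent_def by auto
  show "tangent_vec \<A> c p 0 = zero_tangent"
    using tangent_vec_coord[OF assms zero] by (simp add: tangent_coord_def zero_tangent_def)
qed

text \<open>
  Condition E0 provides the normalisation under which a pulled-back Newton step approximates the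
  Newton step in the chart, and keeps the map inside the chart domain near the zero vector.
\<close>

lemma local_rep_at_zero:
  assumes M: "C2_manifold \<A>" and c: "c \<in> charts_at \<A> p"
    and \<phi>0: "\<phi> zero_tangent = p" and D: "has_differential_at_zero \<A> p \<phi> id"
  shows "local_rep \<A> c p \<phi> 0 = snd c p"
    and "(local_rep \<A> c p \<phi> has_derivative id) (at 0)"
    and "\<forall>\<^sub>F y in nhds 0. \<phi> (tangent_vec \<A> c p y) \<in> fst c"
proof -
  show "local_rep \<A> c p \<phi> 0 = snd c p"
    by (simp add: local_rep_def tangent_vec_zero(1)[OF M c] \<phi>0)
  have "tangent_coord c \<circ> id \<circ> tangent_vec \<A> c p = id"
    by (simp add: fun_eq_iff tangent_coord_vec[OF M c])
  then show "(local_rep \<A> c p \<phi> has_derivative id) (at 0)"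
    and "\<forall>\<^sub>F y in nhds 0. \<phi> (tangent_vec \<A> c p y) \<in> fst c"
    using D c unfolding has_differential_at_zero_def local_rep_def \<phi>0 by metis+
qed

theorem corollary13:
  fixes \<A> :: "('m::{t2_space, second_countable_topology}, 'n::finite) chart set"
    and f :: "'m \<Rightarrow> real" and pstar :: 'm
    and U0 :: "'m set" and \<phi>0 :: "'m \<Rightarrow> real^'n" and \<eta> :: real
    and \<Sigma> :: "'m \<Rightarrow> ('m, 'n) param_pair set"
    and \<sigma> :: "nat \<Rightarrow> 'm list \<Rightarrow> 'm \<Rightarrow> ('m, 'n) param_pair"
  assumes "C2_manifold \<A>"
    and "C2_fun \<A> f"
    and "nondegenerate_critical_point \<A> f pstar"
    and "(U0, \<phi>0) \<in> charts_at \<A> pstar" and "\<phi>0 pstar = 0" and "\<eta> > 0"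
    and "\<And>x. x \<in> \<phi>0 ` U0 \<Longrightarrow>
           norm ((hessian (f \<circ> inv_into U0 \<phi>0) x - hessian (f \<circ> inv_into U0 \<phi>0) 0) *v x)
             \<le> \<eta> * (norm x)\<^sup>2"
    and "satisfies_E0_E2 \<A> \<Sigma>"
    and "is_selection_rule \<Sigma> \<sigma>"
  shows "converges_locally_quadratically \<A> (path_newton \<A> f \<sigma>) pstar"
proof -
  note M = assms(1)
  have crit: "critical_point \<A> f pstar"
    using assms(3) by (simp add: nondegenerate_critical_point_def)
  obtain U \<phi> \<rho> \<alpha> \<beta> where c: "(U, \<phi>) \<in> charts_at \<A> pstar" and \<phi>0: "\<phi> pstar = 0" and \<rho>: "\<rho> > 0"
    and E: "\<And>p s. p \<in> U \<Longrightarrow> s \<in> \<Sigma> p \<Longrightarrow> E0 \<A> p s \<and> E1 \<A> (U, \<phi>) \<alpha> p s \<and> E2 \<A> (U, \<phi>) \<rho> \<beta> p s"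
    using assms(8) unfolding satisfies_E0_E2_def by metis
  let ?c = "(U, \<phi>)" and ?F = "f \<circ> inv_into U \<phi>"
  have "newton_consistent (f \<circ> inv_into U0 \<phi>0) 0"
    by (rule newton_consistent_at_critical_point[OF assms(2) crit assms(4,5) _ assms(7)]) (use assms(6) in auto)
  then have F: "newton_consistent ?F 0"
    using newton_consistent_all_charts[OF M assms(4) c, of f] assms(5) \<phi>0 by simp
  have "invertible (hessian ?F 0)"
    using assms(3) c \<phi>0 unfolding nondegenerate_critical_point_def by force
  from newton_step_quadratic[OF F this, of \<alpha>]
  obtain r K where r: "r > 0" and K: "K \<ge> 0"
    and newton: "\<forall>x h B g. dist x 0 < r \<longrightarrow> h 0 = x \<longrightarrow> (h has_derivative id) (at 0) \<longrightarrow>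
       has_second_derivative h B 0 \<longrightarrow> norm B \<le> \<alpha> \<longrightarrow> (\<forall>\<^sub>F y in nhds 0. ?F (h y) = g y) \<longrightarrow>
       newton_defined g 0 \<and> norm (newton g 0 + (x - 0)) \<le> K * (norm (x - 0))\<^sup>2"
    by blast
  \<comment> \<open>For \<open>norm (\<phi> p) < d\<close> the Newton step has norm at most \<open>(1 + K) * norm (\<phi> p) < \<rho>\<close>, so E2 applies.\<close>
  define d where "d = min r (min 1 (\<rho> / (1 + K)))"
  define \<kappa> where "\<kappa> = K + \<bar>\<beta>\<bar> * (1 + K)\<^sup>2"
  show ?thesis
  proof (rule quadratic_steps_imp_converges_locally_quadratically[OF c \<phi>0, where r = d and \<kappa> = \<kappa>])
    show "d > 0" using r \<rho> K by (simp add: d_def)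
    fix k and ps :: "'m list" and p
    assume ps: "length ps = k" and p: "p \<in> U" "norm (\<phi> p) < d"
    obtain \<phi>p \<psi>p where \<sigma>: "\<sigma> k ps p = (\<phi>p, \<psi>p)" by fastforce
    have "(\<phi>p, \<psi>p) \<in> \<Sigma> p"
      using assms(9) ps \<sigma> unfolding is_selection_rule_def by metis
    from E[OF p(1) this] have
      \<phi>p: "\<phi>p zero_tangent = p" "has_differential_at_zero \<A> p \<phi>p id"
      and E1: "\<exists>B. has_second_derivative (local_rep \<A> ?c p \<phi>p) B 0 \<and> second_derivative_norm B \<le> \<alpha>"
      and E2: "\<And>y. norm y < \<rho> \<Longrightarrow> \<psi>p (tangent_vec \<A> ?c p y) \<in> U \<and>
        norm (local_rep \<A> ?c p \<psi>p y - \<phi> p - y) \<le> \<beta> * (norm y)\<^sup>2"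
      by (auto simp: E0_def E1_def E2_def)
    have cp: "?c \<in> charts_at \<A> p" using c p(1) by (simp add: charts_at_def)
    note zero = tangent_vec_zero[OF M cp]
    let ?g = "f \<circ> \<phi>p \<circ> tangent_vec \<A> ?c p" and ?h = "local_rep \<A> ?c p \<phi>p" and ?x = "\<phi> p"
    note h = local_rep_at_zero[where \<phi> = \<phi>p, OF M cp \<phi>p]
    have inv: "inv_into U \<phi> (\<phi> q) = q" if "q \<in> U" for q
      using c that by (auto simp: charts_at_def C2_charts_def is_chart_def homeomorphism_def)
    have g: "\<forall>\<^sub>F y in nhds 0. ?F (?h y) = ?g y"
      using h(3) by eventually_elim (simp add: local_rep_def inv)
    obtain B where B: "has_second_derivative ?h B 0" "norm B \<le> \<alpha>"
      using E1 norm_le_second_derivative_norm order_trans by metis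
    define y where "y = newton ?g 0"
    have "newton_defined ?g 0 \<and> norm (y + (?x - 0)) \<le> K * (norm (?x - 0))\<^sup>2"
      unfolding y_def
      by (rule newton[rule_format, OF _ _ h(2) B g]) (use p h(1) in \<open>auto simp: d_def\<close>)
    then have nd: "newton_defined ?g 0" and yx: "norm (y + ?x) \<le> K * (norm ?x)\<^sup>2" by auto
    have z0: "tangent_coord ?c zero_tangent = 0" by (simp add: tangent_coord_def zero_tangent_def)
    note tn = tangent_newton_chart_independent[OF M cp zero(2), of "f \<circ> \<phi>p", unfolded z0]
    let ?q = "\<psi>p (tangent_vec \<A> ?c p y)"
    have step: "path_newton \<A> f \<sigma> k ps p = Some ?q"
      using tn nd by (simp add: path_newton_def \<sigma> y_def)
    have "(norm ?x)\<^sup>2 \<le> norm ?x"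
      using p(2) by (simp add: d_def power2_eq_square mult_left_le)
    then have "K * (norm ?x)\<^sup>2 \<le> K * norm ?x" using K by (rule mult_left_mono)
    moreover have "norm y \<le> norm (y + ?x) + norm ?x" using norm_triangle_ineq4[of "y + ?x" ?x] by simp
    ultimately have y: "norm y \<le> (1 + K) * norm ?x" using yx by (simp add: algebra_simps)
    also have "\<dots> < \<rho>" using p(2) K by (simp add: d_def field_simps)
    finally have q: "?q \<in> U" "norm (\<phi> ?q - ?x - y) \<le> \<beta> * (norm y)\<^sup>2"
      using E2[of y] by (auto simp: local_rep_def)
    have "norm (\<phi> ?q) \<le> norm (\<phi> ?q - ?x - y) + norm (y + ?x)"
      using norm_triangle_ineq[of "\<phi> ?q - ?x - y" "y + ?x"] by simp
    also have "\<dots> \<le> \<bar>\<beta>\<bar> * ((1 + K) * norm ?x)\<^sup>2 + K * (norm ?x)\<^sup>2"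
    proof (rule add_mono[OF order_trans[OF q(2)] yx])
      show "\<beta> * (norm y)\<^sup>2 \<le> \<bar>\<beta>\<bar> * ((1 + K) * norm ?x)\<^sup>2"
        using power_mono[OF y, of 2] by (intro mult_mono) auto
    qed
    also have "\<dots> = \<kappa> * (norm ?x)\<^sup>2" unfolding \<kappa>_def power_mult_distrib by (simp add: algebra_simps)
    finally show "\<exists>p'\<in>U. path_newton \<A> f \<sigma> k ps p = Some p' \<and> norm (\<phi> p') \<le> \<kappa> * (norm ?x)\<^sup>2"
      using step q(1) by blast
  qed
qed

end
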